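(* For every real number $p>1$ and every pair of relatively prime natural numbers $(n,m)$ satisfying $m<2n<\sqrt{2}\,m$, there exists a closed $p$-elastic curve in the hyperbolic plane $\mathbb{H}_0^2$ with nonconstant curvature.
   Context: $\mathbb{L}^3$ is $\mathbb{R}^3$ with the metric $\langle\cdot,\cdot\rangle=dx^2+dy^2-dz^2$. The hyperbolic plane is $\mathbb{H}_0^2=\{(x,y,z)\in\mathbb{R}^3 : x^2+y^2-z^2=-1,\ z>0\}$ with the Riemannian metric induced from $\mathbb{L}^3$ (curvature $-1$) and Levi-Civita connection $\nabla$. Curves are smooth, immersed and parameterized by arc length $s$. With $T=\gamma'$ and $N$ the unit normal such that $\{T,N\}$ is positively oriented, the signed geodesic curvature $\kappa$ is defined by $\nabla_TT=\kappa N$. A $p$-elastic curve in $\mathbb{H}_0^2$ is a curve whose curvature $\kappa$ satisfies $$p\,\frac{d^2}{ds^2}\left(\kappa^{p-1}\right)+(p-1)\kappa^{p+1}-p\,\kappa^{p-1}=0 ;$$ if $p$ is not a natural number, only convex curves ($\kappa>0$ everywhere) are considered. A curve is closed if it is defined on $\mathbb{R}$ and periodic, $\gamma(s+L)=\gamma(s)$ for some $L>0$ and all $s$. *)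

theory Defs
  imports "HOL-Analysis.Analysis"
begin

definition lorentz :: "real^3 \<Rightarrow> real^3 \<Rightarrow> real" where
  "lorentz u v = u$1 * v$1 + u$2 * v$2 - u$3 * v$3"

definition hyperbolic_plane :: "(real^3) set" where
  "hyperbolic_plane = {x. lorentz x x = -1 \<and> x$3 > 0}"

definition vderiv :: "(real \<Rightarrow> real^3) \<Rightarrow> real \<Rightarrow> real^3" where
  "vderiv f s = vector_derivative f (at s)"

definition smooth_map :: "(real \<Rightarrow> real^3) \<Rightarrow> bool" where
  "smooth_map f \<longleftrightarrow> (\<forall>k. (vderiv ^^ k) f differentiable_on UNIV)"

text \<open>Since x itself is normal to the hyperboloid at x and <x,x> = -1, the
  Lorentz-orthogonal projection onto the tangent plane at x is v + <v,x> x.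
  The Levi-Civita connection of the induced metric is the tangential part of the
  flat connection of the ambient space.  The lemmas below record its characteristic properties:
  it takes tangent values, is compatible with the metric, and is torsion free.\<close>

definition tangential_part :: "real^3 \<Rightarrow> real^3 \<Rightarrow> real^3" where
  "tangential_part x v = v + lorentz v x *\<^sub>R x"

definition cov_deriv :: "(real \<Rightarrow> real^3) \<Rightarrow> (real \<Rightarrow> real^3) \<Rightarrow> real \<Rightarrow> real^3" where
  "cov_deriv \<gamma> X s = tangential_part (\<gamma> s) (vderiv X s)"

lemma cov_deriv_tangent:
  assumes "\<gamma> s \<in> hyperbolic_plane"
  shows "lorentz (cov_deriv \<gamma> X s) (\<gamma> s) = 0"
proof -
  have "lorentz (v + a *\<^sub>R x) x = lorentz v x + a * lorentz x x" for v x a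
    by (simp add: lorentz_def algebra_simps)
  then show ?thesis
    using assms by (simp add: cov_deriv_def tangential_part_def hyperbolic_plane_def)
qed

lemma cov_deriv_metric:
  assumes X: "X differentiable (at s)" and Y: "Y differentiable (at s)"
    and tX: "lorentz (X s) (\<gamma> s) = 0" and tY: "lorentz (Y s) (\<gamma> s) = 0"
  shows "((\<lambda>t. lorentz (X t) (Y t)) has_real_derivative
      lorentz (cov_deriv \<gamma> X s) (Y s) + lorentz (X s) (cov_deriv \<gamma> Y s)) (at s)"
proof -
  have comp: "((\<lambda>t. Z t $ i) has_real_derivative vderiv Z s $ i) (at s)"
    if "Z differentiable (at s)" for Z :: "real \<Rightarrow> real^3" and i
    using bounded_linear.has_vector_derivative[OF bounded_linear_vec_nth
        that[unfolded vector_derivative_works]]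
    by (simp add: vderiv_def has_real_derivative_iff_has_vector_derivative)
  have "((\<lambda>t. lorentz (X t) (Y t)) has_real_derivative
      lorentz (vderiv X s) (Y s) + lorentz (X s) (vderiv Y s)) (at s)"
    unfolding lorentz_def
    by (rule derivative_eq_intros comp X Y refl)+ (simp add: algebra_simps)
  moreover have "lorentz (v + a *\<^sub>R x) w = lorentz v w + a * lorentz w x"
    "lorentz w (v + a *\<^sub>R x) = lorentz w v + a * lorentz w x" for v w x a
    by (simp_all add: lorentz_def algebra_simps)
  ultimately show ?thesis
    using tX tY by (simp add: cov_deriv_def tangential_part_def)
qed

lemma cov_deriv_torsion_free:
  fixes f :: "real \<Rightarrow> real \<Rightarrow> real^3"
  assumes "vderiv (\<lambda>a. vderiv (f a) v) u = vderiv (\<lambda>b. vderiv (\<lambda>a. f a b) u) v"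
  shows "cov_deriv (\<lambda>a. f a v) (\<lambda>a. vderiv (f a) v) u = cov_deriv (f u) (\<lambda>b. vderiv (\<lambda>a. f a b) u) v"
  using assms by (simp add: cov_deriv_def)

text \<open>An arc length parameterization is automatically immersed.  All curves are defined on
  the whole line, as closed curves are.\<close>

definition unit_speed_curve :: "(real \<Rightarrow> real^3) \<Rightarrow> bool" where
  "unit_speed_curve \<gamma> \<longleftrightarrow>
     smooth_map \<gamma> \<and> (\<forall>s. \<gamma> s \<in> hyperbolic_plane) \<and> (\<forall>s. lorentz (vderiv \<gamma> s) (vderiv \<gamma> s) = 1)"

text \<open>Orientation: a tangent basis (u,v) at x is positive iff det(x,u,v) > 0; equivalently,
  its vertical projection to the xy-plane is positively oriented.\<close>

definition positively_oriented :: "real^3 \<Rightarrow> real^3 \<Rightarrow> real^3 \<Rightarrow> bool" where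
  "positively_oriented x u v \<longleftrightarrow> det (vector [x, u, v] :: real^3^3) > 0"

definition unit_normal :: "(real \<Rightarrow> real^3) \<Rightarrow> (real \<Rightarrow> real^3) \<Rightarrow> bool" where
  "unit_normal \<gamma> N \<longleftrightarrow> (\<forall>s. lorentz (N s) (\<gamma> s) = 0 \<and> lorentz (N s) (vderiv \<gamma> s) = 0 \<and>
     lorentz (N s) (N s) = 1 \<and> positively_oriented (\<gamma> s) (vderiv \<gamma> s) (N s))"

text \<open>For a unit speed curve, N and hence \<open>\<kappa>\<close> are uniquely determined.\<close>

definition signed_curvature :: "(real \<Rightarrow> real^3) \<Rightarrow> (real \<Rightarrow> real) \<Rightarrow> bool" where
  "signed_curvature \<gamma> \<kappa> \<longleftrightarrow>
     (\<exists>N. unit_normal \<gamma> N \<and> (\<forall>s. cov_deriv \<gamma> (vderiv \<gamma>) s = \<kappa> s *\<^sub>R N s))"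

text \<open>Integer exponents must be the algebraic power, since for integer p the curvature may vanish
  or be negative; for x > 0 both branches agree with \<open>x powr a\<close>.\<close>

definition rpow :: "real \<Rightarrow> real \<Rightarrow> real" where
  "rpow x a = (if a \<in> \<int> then x powi \<lfloor>a\<rfloor> else x powr a)"

lemma rpow_pos: "x > 0 \<Longrightarrow> rpow x a = x powr a"
  by (auto simp: rpow_def powr_real_of_int' elim!: Ints_cases)

lemma rpow_of_nat: "rpow x (real k) = x ^ k"
  by (simp add: rpow_def)

text \<open>The curvature of a smooth unit speed curve is smooth, and so, under the convexity
  clause and for p > 1, is its (p-1)-th power; the iterated \<open>deriv\<close> is thus a genuine derivative.\<close>

definition p_elastic :: "real \<Rightarrow> (real \<Rightarrow> real^3) \<Rightarrow> (real \<Rightarrow> real) \<Rightarrow> bool" where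
  "p_elastic p \<gamma> \<kappa> \<longleftrightarrow>
     unit_speed_curve \<gamma> \<and> signed_curvature \<gamma> \<kappa> \<and>
     (p \<notin> \<nat> \<longrightarrow> (\<forall>s. \<kappa> s > 0)) \<and>
     (\<forall>s. p * (deriv ^^ 2) (\<lambda>t. rpow (\<kappa> t) (p - 1)) s
          + (p - 1) * rpow (\<kappa> s) (p + 1) - p * rpow (\<kappa> s) (p - 1) = 0)"

definition closed_curve :: "(real \<Rightarrow> real^3) \<Rightarrow> bool" where
  "closed_curve \<gamma> \<longleftrightarrow> (\<exists>L>0. \<forall>s. \<gamma> (s + L) = \<gamma> s)"

end

theory Submission
  imports Defs "HOL-Real_Asymp.Real_Asymp"
begin

text \<open>Write q = p / (p - 1) and look for the curve in rotational coordinates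
(r cos \<theta>, r sin \<theta>, z) with r^2 = z^2 - 1.  The elastic equation has a conserved
ambient vector; when it is timelike and is placed along the third axis, (p - 1)-th powers of the
curvature become proportional to the height, \<kappa> = q C z^(q - 1) for a constant C > 0, and unit
speed together with the Clairaut-type relation r^2 \<theta>' = C z^q leaves the height equation
z'^2 = z^2 - 1 - C^2 z^(2 q).  Conversely a function z > 1 that satisfies this equation and the
differentiated one, z'' = z - q C^2 z^(2 q - 1), gives a p-elastic curve (lemma
p_elastic_of_height_equation).  For an oscillating z it remains to choose C such that the angle
\<Lambda> swept during one oscillation equals 2 \<pi> n / m: after m oscillations the curve then closes up.

The function f x = x^q / (x - 1) governs everything: with x = z^2 the square of the sine of the
angle between the curve and the meridians is C^2 f x, so a turning point of z is a point where
f x = 1 / C^2.  On x > 1 the function f tends to infinity at both ends and has a single critical point,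
a nondegenerate minimum at x = p.  Hence there is a global coordinate y with
f x = f p + y^2 (lemmas morse_coordinate and clairaut_coordinate).  An orbit is
y = \<rho> sin \<phi> with 1 / C^2 = f p + \<rho>^2, and both ds / d\<phi> and d\<theta> / d\<phi> are then continuous
functions free of the square root singularities at the turning points.  Moreover
d\<theta> / d\<phi> = \<Theta> (\<rho> sin \<phi>) for one function \<Theta> which does not depend on \<rho>, so
\<Lambda> \<rho> is the integral of \<Theta> (\<rho> sin \<phi>) over a full period of \<phi>.

This makes the behaviour of \<Lambda> transparent.  It is continuous; \<Theta> 0 = 1 / sqrt 2 gives
\<Lambda> 0 = sqrt 2 \<pi>, the value for small oscillations about the circle; and \<Theta> tends to 1 at minus
infinity and to 0 at plus infinity (lemma angle_density_profile), so by dominated convergence \<Lambda> \<rho>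
tends to \<pi> for large \<rho>.  The hypothesis m < 2 n < sqrt 2 m says precisely that 2 \<pi> n / m lies
strictly between these two values, and the intermediate value theorem applies (lemma
sinusoidal_average_attains).\<close>

section \<open>Calculus on the line\<close>

text \<open>The one-dimensional Morse lemma: the coordinate (x - c) * S x is the signed square root of f x - f c.
It is continuously differentiable even at c because (f x - f c) / (x - c)^2 has the positive limit
k c / 2 there.  The factorised form (x - c) * k x of the derivative encodes both that c is the only
critical point and that it is a nondegenerate minimum.\<close>

lemma morse_coordinate:
  fixes f k :: "real \<Rightarrow> real" and c :: real
  assumes I: "open I" "is_interval I" and c: "c \<in> I"
    and f: "\<And>x. x \<in> I \<Longrightarrow> (f has_real_derivative (x - c) * k x) (at x)"
    and k: "continuous_on I k" "\<And>x. x \<in> I \<Longrightarrow> k x > 0"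
  obtains S where "continuous_on I S" "\<And>x. x \<in> I \<Longrightarrow> S x > 0"
    "\<And>x. x \<in> I \<Longrightarrow> f x = f c + ((x - c) * S x)\<^sup>2"
    "\<And>x. x \<in> I \<Longrightarrow> ((\<lambda>x. (x - c) * S x) has_real_derivative k x / (2 * S x)) (at x)"
    "S c = sqrt (k c / 2)"
proof -
  have gt: "f x > f c" if "x \<in> I" "x \<noteq> c" for x
  proof -
    have seg: "y \<in> I" if "y \<in> {min x c..max x c}" for y
      using mem_is_interval_1_I[OF I(2) c \<open>x \<in> I\<close>] mem_is_interval_1_I[OF I(2) \<open>x \<in> I\<close> c] that
      by (cases "x < c") (auto simp: min_def max_def split: if_splits)
    \<comment> \<open>The mean value point lies on the same side of c as x, which fixes the sign of the increment.\<close>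
    have "\<exists>y. f x - f c = (x - c) * ((y - c) * k y) \<and> y \<in> I \<and> (x - c) * (y - c) > 0"
    proof (cases "c < x")
      case True
      with MVT2[of c x f "\<lambda>y. (y - c) * k y"] obtain y where
        "c < y" "y < x" "f x - f c = (x - c) * ((y - c) * k y)" using f seg by auto
      then show ?thesis using seg True by (intro exI[of _ y]) auto
    next
      case False
      with MVT2[of x c f "\<lambda>y. (y - c) * k y"] that obtain y where
        "x < y" "y < c" "f c - f x = (c - x) * ((y - c) * k y)" using f seg by force
      have "f x - f c = (x - c) * ((y - c) * k y)"
        using \<open>f c - f x = _\<close> by (simp add: algebra_simps)
      moreover have "(x - c) * (y - c) > 0"
        using \<open>x < y\<close> \<open>y < c\<close> by (intro mult_neg_neg) auto
      ultimately show ?thesis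
        using seg \<open>x < y\<close> \<open>y < c\<close> by (intro exI[of _ y]) auto
    qed
    then obtain y where y: "f x - f c = ((x - c) * (y - c)) * k y" "y \<in> I" "(x - c) * (y - c) > 0"
      by (auto simp: mult.assoc)
    have "f x - f c > 0" unfolding y(1) using y(3) k(2)[OF y(2)] by (rule mult_pos_pos)
    then show ?thesis by simp
  qed
  define S where "S x = (if x = c then sqrt (k c / 2) else sqrt (f x - f c) / \<bar>x - c\<bar>)" for x
  have Spos: "S x > 0" if "x \<in> I" for x
    using gt[OF that] k(2)[OF c] by (auto simp: S_def)
  have evI: "eventually (\<lambda>x. x \<in> I) (at c)"
    using I(1) c by (rule eventually_at_in_open')
  have contf: "continuous_on I f"
    using f DERIV_isCont continuous_at_imp_continuous_on by blast
  \<comment> \<open>The only delicate point is the minimum itself, where de l'Hospital's rule evaluates the square of S.\<close>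
  have lim: "((\<lambda>x. (f x - f c) / (x - c)\<^sup>2) \<longlongrightarrow> k c / 2) (at c)"
  proof (rule lhopital)
    have "(f \<longlongrightarrow> f c) (at c)"
      using contf c I(1) by (metis continuous_on_eq_continuous_at isCont_def)
    then show "((\<lambda>x. f x - f c) \<longlongrightarrow> 0) (at c)" using LIM_zero by blast
    show "((\<lambda>x. (x - c)\<^sup>2) \<longlongrightarrow> 0) (at c)"
      by (rule tendsto_eq_intros refl | simp)+
    show "eventually (\<lambda>x. (x - c)\<^sup>2 \<noteq> 0) (at c)"
      by (auto simp: eventually_at_filter)
    show "eventually (\<lambda>x. 2 * (x - c) \<noteq> 0) (at c)"
      by (auto simp: eventually_at_filter)
    show "eventually (\<lambda>x. ((\<lambda>x. f x - f c) has_real_derivative (x - c) * k x) (at x)) (at c)"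
      using evI by eventually_elim (auto intro!: derivative_eq_intros f)
    show "eventually (\<lambda>x. ((\<lambda>x. (x - c)\<^sup>2) has_real_derivative 2 * (x - c)) (at x)) (at c)"
      by (auto intro!: derivative_eq_intros always_eventually)
    have "(k \<longlongrightarrow> k c) (at c)"
      using k(1) c I(1) by (metis continuous_on_eq_continuous_at isCont_def)
    then have "((\<lambda>x. k x / 2) \<longlongrightarrow> k c / 2) (at c)" by (intro tendsto_intros) auto
    moreover have "eventually (\<lambda>x. k x / 2 = (x - c) * k x / (2 * (x - c))) (at c)"
      unfolding eventually_at_filter by (intro always_eventually) (simp add: field_simps)
    ultimately show "((\<lambda>x. (x - c) * k x / (2 * (x - c))) \<longlongrightarrow> k c / 2) (at c)"
      by (rule Lim_transform_eventually)
  qed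
  have Sc: "isCont S c"
  proof -
    have "((\<lambda>x. sqrt ((f x - f c) / (x - c)\<^sup>2)) \<longlongrightarrow> sqrt (k c / 2)) (at c)"
      by (intro tendsto_intros lim)
    moreover have "eventually (\<lambda>x. sqrt ((f x - f c) / (x - c)\<^sup>2) = S x) (at c)"
      by (auto simp: eventually_at_filter S_def real_sqrt_divide)
    ultimately have "(S \<longlongrightarrow> sqrt (k c / 2)) (at c)" by (rule Lim_transform_eventually)
    then show ?thesis by (simp add: isCont_def S_def)
  qed
  have sq: "f x = f c + ((x - c) * S x)\<^sup>2" if "x \<in> I" for x
    using gt[OF that] by (auto simp: S_def power_mult_distrib power_divide)
  have der: "((\<lambda>x. (x - c) * S x) has_real_derivative k x / (2 * S x)) (at x)" if x: "x \<in> I" for x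
  proof (cases "x = c")
    case True
    have "((\<lambda>x. (x - c) * S x) has_real_derivative S c) (at c)"
      unfolding CARAT_DERIV using Sc by (intro exI[of _ S]) auto
    moreover have "k c / (2 * S c) = S c"
    proof -
      have "S c * S c = k c / 2" using k(2)[OF c] by (simp add: S_def)
      then show ?thesis using Spos[OF c] by (simp add: field_simps)
    qed
    ultimately show ?thesis using True by simp
  next
    case False
    have "((\<lambda>y. sgn (x - c) * sqrt (f y - f c)) has_real_derivative
            sgn (x - c) * ((x - c) * k x / (2 * sqrt (f x - f c)))) (at x)"
    proof (rule DERIV_cmult)
      have D0: "((\<lambda>y. f y - f c) has_real_derivative (x - c) * k x) (at x)"
        using DERIV_diff[OF f[OF x] DERIV_const[of "f c"]] by simp
      have "(sqrt has_real_derivative inverse (sqrt (f x - f c)) / 2) (at (f x - f c))"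
        using gt[OF x False] by (intro DERIV_real_sqrt) simp
      from DERIV_chain2[where g = "\<lambda>y. f y - f c", OF this D0]
      show "((\<lambda>y. sqrt (f y - f c)) has_real_derivative (x - c) * k x / (2 * sqrt (f x - f c))) (at x)"
        by (simp add: field_simps)
    qed
    moreover have "sgn (x - c) * ((x - c) * k x / (2 * sqrt (f x - f c))) = k x / (2 * S x)"
      using False gt[OF x False] by (cases "x < c") (simp_all add: S_def divide_simps algebra_simps)
    ultimately have D: "((\<lambda>y. sgn (x - c) * sqrt (f y - f c)) has_real_derivative k x / (2 * S x)) (at x)"
      by simp
    show ?thesis
    proof (cases "x < c")
      case True
      then show ?thesis
        by (intro has_field_derivative_transform_within_open[OF D, of "{..<c}"])
          (auto simp: S_def divide_simps algebra_simps)
    next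
      case False
      with \<open>x \<noteq> c\<close> show ?thesis
        by (intro has_field_derivative_transform_within_open[OF D, of "{c<..}"]) (auto simp: S_def)
    qed
  qed
  have "isCont S x" if x: "x \<in> I" for x
  proof (cases "x = c")
    case False
    have "isCont (\<lambda>x. sqrt (f x - f c) / \<bar>x - c\<bar>) x"
      using False DERIV_isCont[OF f[OF x]] by (intro continuous_intros) auto
    moreover have "eventually (\<lambda>y. y \<noteq> c) (nhds x)"
      using False by (simp add: t1_space_nhds)
    then have "eventually (\<lambda>y. S y = sqrt (f y - f c) / \<bar>y - c\<bar>) (nhds x)"
      by eventually_elim (simp add: S_def)
    ultimately show ?thesis
      using isCont_cong[of S "\<lambda>y. sqrt (f y - f c) / \<bar>y - c\<bar>" x] by simp
  qed (use Sc in simp)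
  then have contS: "continuous_on I S" by (simp add: continuous_at_imp_continuous_on)
  show thesis
    by (rule that[of S]) (fact contS, erule Spos, erule sq, erule der, simp add: S_def)
qed

text \<open>Both the profile of an elastic curve and its arc length parameter arise by inverting a strictly
increasing function, the first with respect to the Morse coordinate, the second with respect to the
phase of the oscillation.\<close>

lemma real_line_diffeomorphism:
  fixes f f' :: "real \<Rightarrow> real"
  assumes f: "\<And>x. (f has_real_derivative f' x) (at x)" and pos: "\<And>x. f' x > 0"
    and lim: "filterlim f at_top at_top" "filterlim f at_bot at_bot"
  obtains g where "\<And>x. g (f x) = x" "\<And>y. f (g y) = y" "strict_mono g"
    "\<And>y. (g has_real_derivative 1 / f' (g y)) (at y)"
    "filterlim g at_top at_top" "filterlim g at_bot at_bot"
proof -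
  have mono: "strict_mono f"
    using DERIV_pos_imp_increasing[of _ _ f] f pos by (metis strict_monoI)
  have cont: "isCont f x" for x using f DERIV_isCont by blast
  have "\<exists>x. f x = y" for y
  proof -
    obtain b where "f b \<ge> y" using lim(1) by (metis eventually_at_top_linorder filterlim_at_top order_refl)
    moreover obtain a where "f a \<le> y" using lim(2) by (metis eventually_at_bot_linorder filterlim_at_bot order_refl)
    moreover have "a \<le> b"
    proof (rule ccontr)
      assume "\<not> a \<le> b"
      then have "f b < f a" using mono by (simp add: strict_monoD)
      with calculation show False by linarith
    qed
    ultimately show ?thesis
      using IVT[of f a y b] cont by auto
  qed
  then obtain g where fg: "\<And>y. f (g y) = y" by metis
  have gf: "g (f x) = x" for x using fg mono by (metis strict_mono_eq)
  have gmono: "strict_mono g"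
    by (rule strict_monoI) (metis fg mono strict_mono_less)
  have gcont: "isCont g y" for y
    using isCont_inverse_function[of 1 "g y" g f] gf cont by (simp add: fg)
  have "(g has_real_derivative 1 / f' (g y)) (at y)" for y
    using DERIV_inverse_function[OF f, of g y "y - 1" "y + 1"] pos[of "g y"] gcont fg
    by (simp add: inverse_eq_divide)
  moreover have "filterlim g at_top at_top"
    unfolding filterlim_at_top eventually_at_top_linorder
    by (metis gf gmono strict_mono_less_eq)
  moreover have "filterlim g at_bot at_bot"
    unfolding filterlim_at_bot eventually_at_bot_linorder
    by (metis gf gmono strict_mono_less_eq)
  ultimately show thesis using that gf fg gmono by blast
qed

lemma continuous_has_antiderivative:
  fixes h :: "real \<Rightarrow> real"
  assumes "continuous_on UNIV h"
  obtains H where "\<And>x. (H has_real_derivative h x) (at x)"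
proof -
  have "\<exists>F. \<forall>x. -\<infinity> < ereal x \<and> ereal x < \<infinity> \<longrightarrow> (F has_vector_derivative h x) (at x)"
    using einterval_antiderivative[of "-\<infinity>" "\<infinity>" h] assms
    by (simp add: continuous_on_eq_continuous_at)
  then show thesis using that by (auto simp: has_real_derivative_iff_has_vector_derivative)
qed

text \<open>The difference between a function and its translate by a period of its derivative is constant.  This
turns periodicity of the integrands into the period of the height and the angle gained per period.\<close>

lemma periodic_derivative_quasiperiodic:
  fixes H h :: "real \<Rightarrow> real"
  assumes H: "\<And>x. (H has_real_derivative h x) (at x)" and h: "\<And>x. h (x + P) = h x"
  shows "H (x + P) = H x + (H P - H 0)"
proof -
  have "((\<lambda>x. H (x + P) - H x) has_real_derivative 0) (at x)" for x
    using DERIV_diff[OF H[of "x + P", unfolded DERIV_shift] H[of x]] by (simp add: h)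
  then have "H (x + P) - H x = H (0 + P) - H 0"
    using DERIV_isconst_all[of "\<lambda>x. H (x + P) - H x" x 0] by simp
  then show ?thesis by simp
qed

section \<open>Turning points and the rotation angle per oscillation\<close>

text \<open>For a unit speed curve of height z with squared height x = z^2 whose angle satisfies r^2 \<theta>' = C z^q, where
q = p / (p - 1), the number C^2 * clairaut p x is the squared sine of the angle between the curve and the
meridian.\<close>

definition clairaut :: "real \<Rightarrow> real \<Rightarrow> real" where
  "clairaut p x = x powr (p / (p - 1)) / (x - 1)"

text \<open>The derivative of the function above divided by x - p, see lemma has_real_derivative_clairaut.\<close>

definition clairaut_slope :: "real \<Rightarrow> real \<Rightarrow> real" where
  "clairaut_slope p x = clairaut p x / ((p - 1) * x * (x - 1))"

lemma clairaut_pos: "x > 1 \<Longrightarrow> clairaut p x > 0"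
  by (simp add: clairaut_def)

lemma clairaut_slope_pos: "p > 1 \<Longrightarrow> x > 1 \<Longrightarrow> clairaut_slope p x > 0"
  by (simp add: clairaut_slope_def clairaut_pos)

lemma has_real_derivative_clairaut:
  assumes "p > 1" "x > 1"
  shows "(clairaut p has_real_derivative (x - p) * clairaut_slope p x) (at x)"
proof -
  have "((\<lambda>x. x powr (p / (p - 1)) / (x - 1)) has_real_derivative
      (p / (p - 1) * x powr (p / (p - 1) - 1) * (x - 1) - x powr (p / (p - 1))) / ((x - 1) * (x - 1))) (at x)"
    using assms by (auto intro!: derivative_eq_intros)
  moreover have "(p / (p - 1) * x powr (p / (p - 1) - 1) * (x - 1) - x powr (p / (p - 1))) / ((x - 1) * (x - 1))
      = (x - p) * clairaut_slope p x"
  proof -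
    have pw: "x powr (p / (p - 1) - 1) = x powr (p / (p - 1)) / x"
      using assms by (simp only: powr_diff powr_one_gt_zero_iff) simp
    show ?thesis
      unfolding clairaut_slope_def clairaut_def pw using assms
      by (simp add: divide_simps del: powr_divide) (simp add: algebra_simps)
  qed
  ultimately show ?thesis by (simp add: clairaut_def[abs_def])
qed

lemma continuous_on_clairaut_slope: "p > 1 \<Longrightarrow> continuous_on {1<..} (clairaut_slope p)"
  unfolding clairaut_slope_def[abs_def] clairaut_def[abs_def]
  by (intro continuous_intros) auto

text \<open>The half line x > 1 is identified with the real line by x = 1 + exp t.  At its left end the pole of
1 / (x - 1) dominates, at its right end the power x^q with q > 1.\<close>

lemma clairaut_at_ends:
  assumes "p > 1"
  shows "filterlim (\<lambda>t. clairaut p (1 + exp t)) at_top at_top"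
    and "filterlim (\<lambda>t. clairaut p (1 + exp t)) at_top at_bot"
proof -
  define q where "q = p / (p - 1)"
  have q: "q > 1" using assms by (simp add: q_def)
  have "exp ((q - 1) * t) \<le> clairaut p (1 + exp t)" for t
  proof -
    have "exp t powr q \<le> (1 + exp t) powr q" using q by (intro powr_mono2) auto
    then have "exp t powr q / exp t \<le> clairaut p (1 + exp t)"
      by (simp add: clairaut_def q_def divide_right_mono)
    also have "exp t powr q / exp t = exp ((q - 1) * t)"
      by (simp add: powr_def algebra_simps flip: exp_diff)
    finally show ?thesis .
  qed
  moreover have "filterlim (\<lambda>t. exp ((q - 1) * t)) at_top at_top"
    using q by real_asymp
  ultimately show "filterlim (\<lambda>t. clairaut p (1 + exp t)) at_top at_top"
    by (blast intro: filterlim_at_top_mono always_eventually)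
  have "exp (- t) \<le> clairaut p (1 + exp t)" for t
  proof -
    have "1 \<le> (1 + exp t) powr q" using q by (intro ge_one_powr_ge_zero) auto
    then show ?thesis by (simp add: clairaut_def q_def exp_minus field_simps)
  qed
  moreover have "filterlim (\<lambda>t::real. exp (- t)) at_top at_bot"
    by real_asymp
  ultimately show "filterlim (\<lambda>t. clairaut p (1 + exp t)) at_top at_bot"
    by (blast intro: filterlim_at_top_mono always_eventually)
qed

text \<open>The Morse coordinate y = (x - p) * S x maps the half line x > 1 onto the whole real line, because the
values at both ends are infinite; X is its inverse and D the derivative of X.  The last
differential relation is the derivative of the equation defining y; the value of D 0 is the one determined
by the second derivative at the minimum.\<close>

lemma clairaut_coordinate:
  assumes p: "p > 1"
  obtains X D :: "real \<Rightarrow> real" where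
    "\<And>y. X y > 1" "\<And>y. clairaut p (X y) = clairaut p p + y\<^sup>2"
    "\<And>y. (X has_real_derivative D y) (at y)" "continuous_on UNIV D" "\<And>y. D y > 0"
    "\<And>y. 2 * y = (X y - p) * clairaut_slope p (X y) * D y"
    "X 0 = p" "D 0 = sqrt (2 / clairaut_slope p p)"
    "(X \<longlongrightarrow> 1) at_bot" "filterlim X at_top at_top"
proof -
  note k_pos = clairaut_slope_pos[OF p]
  obtain S where contS: "continuous_on {1<..} S" and S_pos: "\<And>x. x > 1 \<Longrightarrow> S x > 0"
    and sq: "\<And>x. x > 1 \<Longrightarrow> clairaut p x = clairaut p p + ((x - p) * S x)\<^sup>2"
    and S_der: "\<And>x. x > 1 \<Longrightarrow>
      ((\<lambda>x. (x - p) * S x) has_real_derivative clairaut_slope p x / (2 * S x)) (at x)"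
    and S_p: "S p = sqrt (clairaut_slope p p / 2)"
    using morse_coordinate[of "{1<..}" p "clairaut p" "clairaut_slope p"] p k_pos
      has_real_derivative_clairaut[OF p] continuous_on_clairaut_slope[OF p]
    by (auto simp: is_interval_oi)
  define F where "F t = (1 + exp t - p) * S (1 + exp t)" for t
  define F' where "F' t = clairaut_slope p (1 + exp t) / (2 * S (1 + exp t)) * exp t" for t
  have F: "(F has_real_derivative F' t) (at t)" for t
  proof -
    have "((\<lambda>t. 1 + exp t) has_real_derivative exp t) (at t)" by (auto intro!: derivative_eq_intros)
    from DERIV_chain2[OF S_der this] show ?thesis
      unfolding F_def[abs_def] F'_def by simp
  qed
  have F'_pos: "F' t > 0" for t
    using k_pos S_pos by (simp add: F'_def)
  have F_sqrt: "\<bar>F t\<bar> = sqrt (clairaut p (1 + exp t) - clairaut p p)" for t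
    using sq[of "1 + exp t"] by (simp add: F_def)
  have gap_top: "filterlim (\<lambda>t. sqrt (clairaut p (1 + exp t) - clairaut p p)) at_top G"
    if "filterlim (\<lambda>t. clairaut p (1 + exp t)) at_top G" for G
    by (rule filterlim_compose[OF sqrt_at_top])
       (use filterlim_tendsto_add_at_top[OF tendsto_const[of "- clairaut p p"] that] in simp)
  have "eventually (\<lambda>t. sqrt (clairaut p (1 + exp t) - clairaut p p) = F t) at_top"
    using eventually_ge_at_top[of "ln p"]
  proof eventually_elim
    case (elim t)
    then have "p \<le> exp t" using p by (metis exp_le_cancel_iff exp_ln less_trans zero_less_one)
    then have "F t \<ge> 0" using S_pos[of "1 + exp t"] by (simp add: F_def)
    then show ?case using F_sqrt[of t] by simp
  qed
  from this gap_top[OF clairaut_at_ends(1)[OF p]] have F_top: "filterlim F at_top at_top"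
    by (rule filterlim_cong[OF refl refl, THEN iffD1])
  have "eventually (\<lambda>t. - sqrt (clairaut p (1 + exp t) - clairaut p p) = F t) at_bot"
    using eventually_le_at_bot[of "ln (p - 1)"]
  proof eventually_elim
    case (elim t)
    then have "exp t \<le> p - 1" using p by (metis diff_gt_0_iff_gt exp_le_cancel_iff exp_ln)
    then have "F t \<le> 0" using S_pos[of "1 + exp t"] by (simp add: F_def mult_nonpos_nonneg)
    then show ?case using F_sqrt[of t] by simp
  qed
  moreover have "filterlim (\<lambda>t. - sqrt (clairaut p (1 + exp t) - clairaut p p)) at_bot at_bot"
    using gap_top[OF clairaut_at_ends(2)[OF p]] by (simp add: filterlim_uminus_at_top)
  ultimately have F_bot: "filterlim F at_bot at_bot"
    by (rule filterlim_cong[OF refl refl, THEN iffD1])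
  obtain g where gF: "\<And>t. g (F t) = t" and Fg: "\<And>y. F (g y) = y"
    and g_der: "\<And>y. (g has_real_derivative 1 / F' (g y)) (at y)"
    and g_lim: "filterlim g at_top at_top" "filterlim g at_bot at_bot"
    using real_line_diffeomorphism[of F F', OF F F'_pos F_top F_bot] by metis
  define X where "X y = 1 + exp (g y)" for y
  define D where "D y = 2 * S (X y) / clairaut_slope p (X y)" for y
  have X_gt: "X y > 1" for y by (simp add: X_def)
  have y_eq: "y = (X y - p) * S (X y)" for y
    using Fg[of y] by (simp add: F_def X_def)
  have X_der: "(X has_real_derivative D y) (at y)" for y
  proof -
    have "((\<lambda>y. 1 + exp (g y)) has_real_derivative exp (g y) * (1 / F' (g y))) (at y)"
      by (auto intro!: derivative_eq_intros g_der)
    moreover have "exp (g y) * (1 / F' (g y)) = D y"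
      using k_pos[of "X y"] S_pos[of "X y"] X_gt[of y] by (simp add: F'_def D_def flip: X_def)
    ultimately show ?thesis by (simp add: X_def[abs_def])
  qed
  have X0: "X 0 = p"
    using y_eq[of 0] S_pos[OF X_gt[of 0]] by simp
  show thesis
  proof (rule that)
    show "X y > 1" for y by (rule X_gt)
    show "clairaut p (X y) = clairaut p p + y\<^sup>2" for y
      using sq[OF X_gt[of y]] y_eq[of y] by simp
    show "(X has_real_derivative D y) (at y)" for y by (rule X_der)
    have contX: "continuous_on UNIV X"
      using X_der DERIV_isCont continuous_at_imp_continuous_on by blast
    have "continuous_on UNIV (\<lambda>y. S (X y))" "continuous_on UNIV (\<lambda>y. clairaut_slope p (X y))"
      using X_gt by (auto intro!: continuous_on_compose2[OF contS contX]
          continuous_on_compose2[OF continuous_on_clairaut_slope[OF p] contX])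
    moreover have "clairaut_slope p (X y) \<noteq> 0" for y using k_pos[OF X_gt[of y]] by simp
    ultimately show "continuous_on UNIV D" unfolding D_def by (auto intro!: continuous_intros)
    show "D y > 0" for y using k_pos[OF X_gt] S_pos[OF X_gt] by (simp add: D_def)
    show "2 * y = (X y - p) * clairaut_slope p (X y) * D y" for y
      using y_eq[of y] k_pos[OF X_gt[of y]] by (simp add: D_def)
    show "X 0 = p" by (rule X0)
    have "(D 0)\<^sup>2 = 2 / clairaut_slope p p"
      using k_pos[OF p] by (simp add: D_def X0 S_p power_divide power_mult_distrib power2_eq_square)
    moreover have "D 0 > 0" using k_pos[OF X_gt] S_pos[OF X_gt] by (simp add: D_def)
    ultimately show "D 0 = sqrt (2 / clairaut_slope p p)"
      by (metis less_imp_le real_sqrt_unique)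
    have "((\<lambda>y. 1 + exp (g y)) \<longlongrightarrow> 1 + 0) at_bot"
      by (intro tendsto_intros filterlim_compose[OF exp_at_bot g_lim(2)])
    then show "(X \<longlongrightarrow> 1) at_bot" by (simp add: X_def[abs_def])
    show "filterlim X at_top at_top"
      unfolding X_def[abs_def]
      by (intro filterlim_tendsto_add_at_top[OF tendsto_const] filterlim_compose[OF exp_at_top g_lim(1)])
  qed
qed

text \<open>The function \<Theta>: if the squared height is X (\<rho> * sin \<phi>), then the derivative of the rotation angle
with respect to the phase \<phi> is angle_density p X D (\<rho> * sin \<phi>), for every amplitude \<rho>.\<close>

definition angle_density :: "real \<Rightarrow> (real \<Rightarrow> real) \<Rightarrow> (real \<Rightarrow> real) \<Rightarrow> real \<Rightarrow> real" where
  "angle_density p X D y = sqrt (clairaut p (X y)) * D y / (2 * sqrt (X y) * (X y - 1))"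

text \<open>Away from y = 0 the relation between y and D y turns the density into the product of
y / sqrt (f p + y^2), which tends to -1 and 1, and (p - 1) sqrt x / (x - p), which tends to -1 as x
tends to 1 and to 0 as x tends to infinity.  Geometrically, the inner half of a large oscillation
is nearly a geodesic through the centre and contributes \<pi>, while the outer half contributes
nothing in the limit.\<close>

lemma angle_density_profile:
  assumes p: "p > 1"
    and X_gt: "\<And>y. X y > 1" and X_eq: "\<And>y. clairaut p (X y) = clairaut p p + y\<^sup>2"
    and X_der: "\<And>y. (X has_real_derivative D y) (at y)" and contD: "continuous_on UNIV D"
    and D_eq: "\<And>y. 2 * y = (X y - p) * clairaut_slope p (X y) * D y"
    and X0: "X 0 = p" and D0: "D 0 = sqrt (2 / clairaut_slope p p)"
    and X_lim: "(X \<longlongrightarrow> 1) at_bot" "filterlim X at_top at_top"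
  shows "continuous_on UNIV (angle_density p X D)" "angle_density p X D 0 = 1 / sqrt 2"
    and "(angle_density p X D \<longlongrightarrow> 1) at_bot" "(angle_density p X D \<longlongrightarrow> 0) at_top"
proof -
  have contX: "continuous_on UNIV X"
    using X_der DERIV_isCont continuous_at_imp_continuous_on by blast
  have X_gt0: "X y > 0" for y using X_gt[of y] by simp
  have ne: "X y \<noteq> 1" "X y \<noteq> 0" for y using X_gt[of y] by auto
  have "angle_density p X D = (\<lambda>y. sqrt (clairaut p p + y\<^sup>2) * D y / (2 * sqrt (X y) * (X y - 1)))"
    by (simp add: angle_density_def X_eq fun_eq_iff)
  then show "continuous_on UNIV (angle_density p X D)"
    using ne contX contD by (auto intro!: continuous_intros)
  show "angle_density p X D 0 = 1 / sqrt 2"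
  proof -
    have "sqrt (clairaut p p) * sqrt (2 / clairaut_slope p p) = sqrt (2 * p) * (p - 1)"
      using p clairaut_pos[OF p, of p]
      by (simp add: clairaut_slope_def power2_eq_square flip: real_sqrt_mult)
         (simp add: real_sqrt_mult)
    then have "angle_density p X D 0 = sqrt (2 * p) * (p - 1) / (2 * sqrt p * (p - 1))"
      by (simp add: angle_density_def X0 D0)
    also have "\<dots> = sqrt 2 / 2"
      using p by (simp add: real_sqrt_mult)
    also have "\<dots> = 1 / sqrt 2"
      by (simp add: field_simps)
    finally show ?thesis .
  qed
  define A where "A y = (y / sqrt (clairaut p p + y\<^sup>2)) * ((p - 1) * sqrt (X y) / (X y - p))" for y
  have A: "angle_density p X D y = A y" if "y \<noteq> 0" for y
  proof -
    define f where "f = clairaut p (X y)"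
    have f0: "f > 0" using clairaut_pos[OF X_gt[of y]] by (simp add: f_def)
    have f: "f > 0" "sqrt f * sqrt f = f" "sqrt (X y) * sqrt (X y) = X y"
      using f0 X_gt0[of y] by (simp_all add: abs_of_pos)
    have Xp: "X y \<noteq> p" using D_eq[of y] that by auto
    have solve: "d = 2 * y * b / (a * f)" if "2 * y = a * (f / b) * d" "a \<noteq> 0" "b \<noteq> 0" for a b d :: real
      using that f0 by (simp add: divide_simps)
    have D: "D y = 2 * y * ((p - 1) * X y * (X y - 1)) / ((X y - p) * f)"
      using D_eq[of y] Xp ne[of y] p by (intro solve) (auto simp: f_def clairaut_slope_def)
    have cancel: "r * (2 * y * (c * x * e) / (a * f)) / (2 * s * e) = r * (y * c * x) / (s * a * f)"
      if "e \<noteq> 0" for r c x e a s :: real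
      using that by (simp add: divide_simps)
    have "angle_density p X D y = sqrt f * (y * (p - 1) * X y) / (sqrt (X y) * (X y - p) * f)"
      unfolding angle_density_def D f_def[symmetric] using ne(1)[of y] by (intro cancel) simp
    also have "\<dots> = (sqrt f * y * (p - 1) * (sqrt (X y) * sqrt (X y))) / (sqrt (X y) * (X y - p) * (sqrt f * sqrt f))"
      by (simp only: f(2,3) mult.assoc)
    also have "\<dots> = A y"
    proof -
      have regroup: "(r * y * c * (s * s)) / (s * a * (r * r)) = (y / r) * (c * s / a)"
        if "r \<noteq> 0" "s \<noteq> 0" for r s a c :: real
        using that by (simp add: divide_simps)
      then show ?thesis
        unfolding A_def X_eq[symmetric] f_def[symmetric] using f(1) ne(2)[of y] by (intro regroup) auto
    qed
    finally show ?thesis .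
  qed
  have "isCont (\<lambda>x. sqrt x / (x - p)) 1" using p by (intro continuous_intros) auto
  from isCont_tendsto_compose[OF this X_lim(1)]
  have lim1: "((\<lambda>y. sqrt (X y) / (X y - p)) \<longlongrightarrow> 1 / (1 - p)) at_bot" by simp
  have "((\<lambda>x. sqrt x / (x - p)) \<longlongrightarrow> 0) at_top"
    by real_asymp
  note lim2 = filterlim_compose[OF this X_lim(2)]
  have a: "((\<lambda>y. y / sqrt (c + y\<^sup>2)) \<longlongrightarrow> -1) at_bot" "((\<lambda>y. y / sqrt (c + y\<^sup>2)) \<longlongrightarrow> 1) at_top" for c :: real
    by real_asymp+
  have "(A \<longlongrightarrow> (-1) * ((p - 1) * (1 / (1 - p)))) at_bot" "(A \<longlongrightarrow> 1 * ((p - 1) * 0)) at_top"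
    unfolding A_def times_divide_eq_right[symmetric] by (intro tendsto_intros a lim1 lim2)+
  moreover have "(-1) * ((p - 1) * (1 / (1 - p))) = 1" using p by (simp add: field_simps)
  moreover have "eventually (\<lambda>y. A y = angle_density p X D y) at_bot"
    using eventually_le_at_bot[of "-1"] by eventually_elim (simp add: A)
  moreover have "eventually (\<lambda>y. A y = angle_density p X D y) at_top"
    using eventually_gt_at_top[of 0] by eventually_elim (simp add: A)
  ultimately show "(angle_density p X D \<longlongrightarrow> 1) at_bot" "(angle_density p X D \<longlongrightarrow> 0) at_top"
    using Lim_transform_eventually[of A _ at_bot] Lim_transform_eventually[of A _ at_top] by auto
qed

text \<open>For large N the argument N * sin \<phi> is very positive on the first half of the period and very
negative on the second, so the integrand converges pointwise to b and a there; it is bounded because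
a continuous function with limits at both ends is.\<close>

lemma sinusoidal_average_tendsto:
  fixes \<Theta> :: "real \<Rightarrow> real"
  assumes cont: "continuous_on UNIV \<Theta>"
    and lim: "(\<Theta> \<longlongrightarrow> a) at_bot" "(\<Theta> \<longlongrightarrow> b) at_top"
  shows "(\<lambda>N. integral {0..2 * pi} (\<lambda>\<phi>. \<Theta> (real N * sin \<phi>))) \<longlonglongrightarrow> pi * (a + b)"
proof -
  obtain B where B: "\<And>y. \<bar>\<Theta> y\<bar> \<le> B"
  proof -
    have "eventually (\<lambda>y. \<bar>\<Theta> y\<bar> < \<bar>a\<bar> + 1) at_bot" "eventually (\<lambda>y. \<bar>\<Theta> y\<bar> < \<bar>b\<bar> + 1) at_top"
      using order_tendstoD(2)[OF tendsto_rabs[OF lim(1)]] order_tendstoD(2)[OF tendsto_rabs[OF lim(2)]] by simp_all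
    then obtain u v where u: "\<And>y. y \<le> u \<Longrightarrow> \<bar>\<Theta> y\<bar> < \<bar>a\<bar> + 1" and v: "\<And>y. y \<ge> v \<Longrightarrow> \<bar>\<Theta> y\<bar> < \<bar>b\<bar> + 1"
      by (auto simp: eventually_at_bot_linorder eventually_at_top_linorder)
    have "compact (\<Theta> ` {u..v})"
      using cont by (intro compact_continuous_image continuous_on_subset[OF cont]) auto
    then obtain M where M: "\<And>y. y \<in> {u..v} \<Longrightarrow> \<bar>\<Theta> y\<bar> \<le> M"
      using compact_imp_bounded bounded_iff by (metis (no_types) imageI real_norm_def)
    have "\<bar>\<Theta> y\<bar> \<le> max M (max (\<bar>a\<bar> + 1) (\<bar>b\<bar> + 1))" for y
      using u[of y] v[of y] M[of y] by (cases "y \<le> u"; cases "y \<ge> v") (auto simp: le_max_iff_disj)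
    then show thesis by (rule that)
  qed
  define g where "g \<phi> = (if sin \<phi> > 0 then b else if sin \<phi> < 0 then a else \<Theta> 0)" for \<phi> :: real
  have pointwise: "(\<lambda>N. \<Theta> (real N * sin \<phi>)) \<longlonglongrightarrow> g \<phi>" for \<phi>
  proof -
    consider "sin \<phi> > 0" | "sin \<phi> < 0" | "sin \<phi> = 0" by linarith
    then show ?thesis
    proof cases
      case 1
      then have "filterlim (\<lambda>N. real N * sin \<phi>) at_top sequentially"
        using filterlim_tendsto_pos_mult_at_top[OF tendsto_const 1 filterlim_real_sequentially]
        by (simp add: mult.commute)
      then show ?thesis using filterlim_compose[OF lim(2)] 1 by (simp add: g_def)
    next
      case 2
      then have "filterlim (\<lambda>N. - (real N * - sin \<phi>)) at_bot sequentially"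
        using filterlim_tendsto_pos_mult_at_top[OF tendsto_const _ filterlim_real_sequentially, of "- sin \<phi>"]
        by (subst filterlim_uminus_at_bot) (simp add: mult.commute)
      then have "filterlim (\<lambda>N. real N * sin \<phi>) at_bot sequentially" by simp
      then show ?thesis using filterlim_compose[OF lim(1)] 2 by (simp add: g_def)
    next
      case 3
      then show ?thesis by (simp add: g_def)
    qed
  qed
  have "(\<lambda>N. integral {0..2 * pi} (\<lambda>\<phi>. \<Theta> (real N * sin \<phi>))) \<longlonglongrightarrow> integral {0..2 * pi} g"
  proof (rule dominated_convergence(2))
    show "(\<lambda>\<phi>. \<Theta> (real N * sin \<phi>)) integrable_on {0..2 * pi}" for N
      by (intro integrable_continuous_real continuous_on_compose2[OF cont] continuous_intros) auto
    show "(\<lambda>_. B) integrable_on {0..2 * pi}" by (rule integrable_const_ivl)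
    show "norm (\<Theta> (real N * sin \<phi>)) \<le> B" for N \<phi> using B by simp
    show "(\<lambda>N. \<Theta> (real N * sin \<phi>)) \<longlonglongrightarrow> g \<phi>" for \<phi> by (rule pointwise)
  qed
  moreover have "(g has_integral (pi * b + pi * a)) {0..2 * pi}"
  proof (rule has_integral_combine)
    have "((\<lambda>_. b) has_integral pi * b) {0..pi}"
      using has_integral_const_real[of b 0 pi] by simp
    then show "(g has_integral pi * b) {0..pi}"
      by (rule has_integral_spike_finite[of "{0, pi}", rotated 2]) (auto simp: g_def sin_gt_zero)
    have "((\<lambda>_. a) has_integral pi * a) {pi..2 * pi}"
      using has_integral_const_real[of a pi "2 * pi"] by simp
    then show "(g has_integral pi * a) {pi..2 * pi}"
    proof (rule has_integral_spike_finite[of "{pi, 2 * pi}", rotated 2])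
      fix x assume "x \<in> {pi..2 * pi} - {pi, 2 * pi}"
      then have "sin x < 0" by (intro sin_lt_zero) auto
      then show "g x = a" by (simp add: g_def)
    qed simp
  qed auto
  ultimately show ?thesis
    by (simp add: integral_unique algebra_simps)
qed

text \<open>The average depends continuously on the amplitude.  At amplitude 0 it is 2 * pi * \<Theta> 0, and the
previous lemma gives its limit for large amplitudes, so every c strictly in between is a value.\<close>

lemma sinusoidal_average_attains:
  fixes \<Theta> :: "real \<Rightarrow> real"
  assumes cont: "continuous_on UNIV \<Theta>"
    and lim: "(\<Theta> \<longlongrightarrow> a) at_bot" "(\<Theta> \<longlongrightarrow> b) at_top"
    and c: "pi * (a + b) < c" "c < 2 * pi * \<Theta> 0"
  obtains \<rho> where "\<rho> > 0" "integral {0..2 * pi} (\<lambda>\<phi>. \<Theta> (\<rho> * sin \<phi>)) = c"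
proof -
  define \<Lambda> where "\<Lambda> \<rho> = integral {0..2 * pi} (\<lambda>\<phi>. \<Theta> (\<rho> * sin \<phi>))" for \<rho>
  have \<Lambda>0: "\<Lambda> 0 = 2 * pi * \<Theta> 0" by (simp add: \<Lambda>_def)
  have "continuous_on UNIV (\<lambda>\<rho>. integral (cbox 0 (2 * pi)) (\<lambda>\<phi>. \<Theta> (\<rho> * sin \<phi>)))"
    by (rule integral_continuous_on_param)
       (auto simp: case_prod_beta intro!: continuous_on_compose2[OF cont] continuous_intros)
  then have cont\<Lambda>: "continuous_on UNIV \<Lambda>" by (simp add: \<Lambda>_def[abs_def])
  have "eventually (\<lambda>N. \<Lambda> (real N) < c) sequentially"
    using order_tendstoD(2)[OF sinusoidal_average_tendsto[OF cont lim] c(1)] by (simp add: \<Lambda>_def)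
  then obtain N where N: "\<Lambda> (real N) < c" by (auto simp: eventually_sequentially)
  obtain \<rho> where \<rho>: "0 \<le> \<rho>" "\<Lambda> \<rho> = c"
    using IVT2'[of \<Lambda> "real N" c 0] N c(2) \<Lambda>0 continuous_on_subset[OF cont\<Lambda>] by auto
  moreover have "\<rho> \<noteq> 0" using \<rho>(2) \<Lambda>0 c(2) by auto
  ultimately show thesis using that[of \<rho>] by (simp add: \<Lambda>_def)
qed

section \<open>Solving the height equation\<close>

lemma filterlim_of_derivative_ge:
  fixes H h :: "real \<Rightarrow> real"
  assumes H: "\<And>x. (H has_real_derivative h x) (at x)" and ge: "\<And>x. h x \<ge> c" and c: "c > 0"
  shows "filterlim H at_top at_top" "filterlim H at_bot at_bot"
proof -
  have mono: "H x - c * x \<le> H y - c * y" if "x \<le> y" for x y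
  proof -
    have "((\<lambda>x. H x - c * x) has_real_derivative h x - c) (at x)" for x
      by (auto intro!: derivative_eq_intros H)
    then show ?thesis
      using DERIV_nonneg_imp_nondecreasing[OF that, of "\<lambda>x. H x - c * x"] ge
      by (metis diff_ge_0_iff_ge)
  qed
  have "eventually (\<lambda>x. H 0 + c * x \<le> H x) at_top"
    using eventually_ge_at_top[of 0] by eventually_elim (use mono[of 0] in force)
  moreover have "filterlim (\<lambda>x. H 0 + c * x) at_top at_top" using c by real_asymp
  ultimately show "filterlim H at_top at_top" by (blast intro: filterlim_at_top_mono)
  have "eventually (\<lambda>x. H x \<le> H 0 + c * x) at_bot"
    using eventually_le_at_bot[of 0] by eventually_elim (use mono[of _ 0] in force)
  moreover have "filterlim (\<lambda>x. H 0 + c * x) at_bot at_bot" using c by real_asymp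
  ultimately show "filterlim H at_bot at_bot" by (blast intro: filterlim_at_bot_mono)
qed

text \<open>The oscillation is constructed by quadrature.  With X the inverse Morse coordinate put z^2 = X (\<rho> sin \<phi>);
the height equation then prescribes ds / d\<phi> as a positive, continuous, periodic function of the phase,
and integrating and inverting it gives \<phi> as a function of the arc length s.  The turning points are the phases where
the cosine vanishes; ds / d\<phi> is regular there.  The constant is determined by
1 / C^2 = f p + \<rho>^2, the common value of f at the two turning points.\<close>

lemma height_equation_solution:
  assumes p: "p > 1" and \<rho>: "\<rho> > 0"
    and X_gt: "\<And>y. X y > 1" and X_eq: "\<And>y. clairaut p (X y) = clairaut p p + y\<^sup>2"
    and X_der: "\<And>y. (X has_real_derivative D y) (at y)"
    and contD: "continuous_on UNIV D" and D_pos: "\<And>y. D y > 0"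
    and D_eq: "\<And>y. 2 * y = (X y - p) * clairaut_slope p (X y) * D y"
    and cont\<Theta>: "continuous_on UNIV (angle_density p X D)"
  obtains z w \<theta> :: "real \<Rightarrow> real" and C P :: real where
    "C > 0" "P > 0" "\<And>s. z s > 1"
    "\<And>s. (z has_real_derivative w s) (at s)"
    "\<And>s. (w has_real_derivative z s - p / (p - 1) * C\<^sup>2 * (z s powr (p / (p - 1)))\<^sup>2 / z s) (at s)"
    "\<And>s. (w s)\<^sup>2 = (z s)\<^sup>2 - 1 - C\<^sup>2 * (z s powr (p / (p - 1)))\<^sup>2"
    "\<And>s. (\<theta> has_real_derivative C * z s powr (p / (p - 1)) / ((z s)\<^sup>2 - 1)) (at s)"
    "\<And>s. z (s + P) = z s"
    "\<And>s. \<theta> (s + P) = \<theta> s + integral {0..2 * pi} (\<lambda>\<phi>. angle_density p X D (\<rho> * sin \<phi>))"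
    "\<exists>s t. z s \<noteq> z t"
proof -
  define q where "q = p / (p - 1)"
  define R where "R = sqrt (clairaut p p + \<rho>\<^sup>2)"
  have R2: "R\<^sup>2 = clairaut p p + \<rho>\<^sup>2" and R: "R > 0"
    using clairaut_pos[OF p, of p] by (simp_all add: R_def add_pos_nonneg)
  have contX: "continuous_on UNIV X"
    using X_der DERIV_isCont continuous_at_imp_continuous_on by blast
  have X_gt0: "X y > 0" for y using X_gt[of y] by simp
  have ne: "X y \<noteq> 1" "X y \<noteq> 0" "D y \<noteq> 0" for y using X_gt[of y] D_pos[of y] by auto
  \<comment> \<open>The function h is ds / d\<phi>; since its values are those of k on a compact interval, it has a positive lower bound.\<close>
  define k where "k y = R * D y / (2 * sqrt (X y) * sqrt (X y - 1))" for y
  define h where "h \<phi> = k (\<rho> * sin \<phi>)" for \<phi>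
  have k_pos: "k y > 0" for y
    using R D_pos X_gt X_gt0 by (simp add: k_def)
  have contk: "continuous_on UNIV k"
    unfolding k_def using ne by (auto intro!: continuous_intros contX contD)
  have conth: "continuous_on UNIV h"
    unfolding h_def by (intro continuous_on_compose2[OF contk] continuous_intros) auto
  obtain c where c: "c > 0" "\<And>\<phi>. h \<phi> \<ge> c"
  proof -
    obtain y where "\<And>x. x \<in> {-\<rho>..\<rho>} \<Longrightarrow> k y \<le> k x"
      using continuous_attains_inf[of "{-\<rho>..\<rho>}" k] \<rho> continuous_on_subset[OF contk subset_UNIV]
      by (metis atLeastAtMost_iff compact_Icc empty_iff less_imp_le neg_le_0_iff_le)
    moreover have "\<rho> * sin \<phi> \<in> {-\<rho>..\<rho>}" for \<phi>
    proof -
      have "\<bar>\<rho> * sin \<phi>\<bar> \<le> \<rho>"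
        using \<rho> mult_left_mono[OF abs_sin_le_one, of \<rho> \<phi>] by (simp add: abs_mult)
      then show ?thesis by (simp add: abs_le_iff)
    qed
    ultimately show thesis using that[of "k y"] k_pos by (simp add: h_def)
  qed
  obtain H where H: "\<And>\<phi>. (H has_real_derivative h \<phi>) (at \<phi>)"
    using continuous_has_antiderivative[OF conth] by metis
  have h_pos: "h \<phi> > 0" for \<phi> using k_pos by (simp add: h_def)
  obtain \<Phi> where \<Phi>H: "\<And>\<phi>. \<Phi> (H \<phi>) = \<phi>" and H\<Phi>: "\<And>s. H (\<Phi> s) = s"
    and \<Phi>_der: "\<And>s. (\<Phi> has_real_derivative 1 / h (\<Phi> s)) (at s)"
    using real_line_diffeomorphism[of H h, OF H h_pos filterlim_of_derivative_ge[OF H c(2,1)]] by metis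
  have cont\<theta>: "continuous_on UNIV (\<lambda>\<phi>. angle_density p X D (\<rho> * sin \<phi>))"
    by (intro continuous_on_compose2[OF cont\<Theta>] continuous_intros) auto
  obtain A where A: "\<And>\<phi>. (A has_real_derivative angle_density p X D (\<rho> * sin \<phi>)) (at \<phi>)"
    using continuous_has_antiderivative[OF cont\<theta>] by metis
  define P where "P = H (2 * pi) - H 0"
  have \<Phi>_shift: "\<Phi> (s + P) = \<Phi> s + 2 * pi" for s
  proof -
    have "H (\<Phi> s + 2 * pi) = s + P"
      using periodic_derivative_quasiperiodic[OF H, of "2 * pi" "\<Phi> s"] by (simp add: h_def H\<Phi> P_def)
    then show ?thesis by (metis \<Phi>H)
  qed
  have A_shift: "A (\<phi> + 2 * pi) = A \<phi> + integral {0..2 * pi} (\<lambda>\<phi>. angle_density p X D (\<rho> * sin \<phi>))" for \<phi>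
  proof -
    have "((\<lambda>\<phi>. angle_density p X D (\<rho> * sin \<phi>)) has_integral A (2 * pi) - A 0) {0..2 * pi}"
      using A by (intro fundamental_theorem_of_calculus)
        (auto simp: has_real_derivative_iff_has_vector_derivative intro: has_vector_derivative_at_within)
    then show ?thesis
      using periodic_derivative_quasiperiodic[OF A, of "2 * pi" \<phi>] by (simp add: integral_unique)
  qed
  define y where "y s = \<rho> * sin (\<Phi> s)" for s
  define z where "z s = sqrt (X (y s))" for s
  define w where "w s = \<rho> * cos (\<Phi> s) * sqrt (X (y s) - 1) / R" for s
  define \<theta> where "\<theta> s = A (\<Phi> s)" for s
  have z2: "(z s)\<^sup>2 = X (y s)" and z_gt: "z s > 1" for s
    using X_gt0[of "y s"] X_gt[of "y s"] by (simp_all add: z_def)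
  have zq: "(z s powr q)\<^sup>2 = clairaut p (X (y s)) * (X (y s) - 1)" for s
  proof -
    have "(z s powr q)\<^sup>2 = (z s)\<^sup>2 powr q"
      using z_gt[of s] by (simp add: power2_eq_square powr_mult)
    then show ?thesis using ne(1)[of "y s"] by (simp add: z2 clairaut_def q_def)
  qed
  have root: "sqrt (X y - 1) * sqrt (X y - 1) = X y - 1" "sqrt (X y - 1) > 0" for y
    using X_gt[of y] by simp_all
  \<comment> \<open>With 1 / C = R the right-hand side is 1 / C^2 - f x, the gap that closes at the turning points.\<close>
  have energy: "\<rho>\<^sup>2 * (cos (\<Phi> s))\<^sup>2 = R\<^sup>2 - clairaut p (X (y s))" for s
    unfolding R2 X_eq y_def by (simp add: power_mult_distrib cos_squared_eq algebra_simps)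
  have Xy_der: "((\<lambda>s. X (y s)) has_real_derivative 2 * z s * w s) (at s)" for s
  proof -
    have "(y has_real_derivative \<rho> * (cos (\<Phi> s) * (1 / h (\<Phi> s)))) (at s)"
      unfolding y_def by (rule DERIV_cmult, rule DERIV_fun_sin[OF \<Phi>_der])
    from DERIV_chain2[OF X_der this]
    have "((\<lambda>s. X (y s)) has_real_derivative D (y s) * (\<rho> * (cos (\<Phi> s) * (1 / h (\<Phi> s))))) (at s)" .
    moreover have "D (y s) * (\<rho> * (cos (\<Phi> s) * (1 / h (\<Phi> s)))) = 2 * z s * w s"
      using R ne(3)[of "y s"] by (simp add: h_def k_def w_def z_def flip: y_def)
    ultimately show ?thesis by simp
  qed
  have z_der: "(z has_real_derivative w s) (at s)" for s
  proof -
    have "(sqrt has_real_derivative inverse (sqrt (X (y s))) / 2) (at (X (y s)))"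
      by (rule DERIV_real_sqrt[OF X_gt0])
    from DERIV_chain2[where g = "\<lambda>s. X (y s)", OF this Xy_der]
    show ?thesis
      using z_gt[of s] by (simp add: z_def[abs_def] field_simps)
  qed
  have w_der: "(w has_real_derivative z s - q * C\<^sup>2 * (z s powr q)\<^sup>2 / z s) (at s)" if C: "C = 1 / R" for s C
  proof -
    define f where "f = clairaut p (X (y s))"
    define x where "x = X (y s)"
    define r where "r = sqrt (x - 1)"
    have pos: "x > 1" "z s > 0" "r > 0" "R > 0" "r * r = x - 1" "z s * z s = x" "f > 0"
      using X_gt[of "y s"] z_gt[of s] root R z2[of s] clairaut_pos[OF X_gt[of "y s"], of p]
      by (simp_all add: x_def r_def f_def power2_eq_square)
    have "((\<lambda>s. X (y s) - 1) has_real_derivative 2 * z s * w s) (at s)"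
      using DERIV_diff[OF Xy_der[of s] DERIV_const[of 1]] by simp
    moreover have "(sqrt has_real_derivative inverse (sqrt (X (y s) - 1)) / 2) (at (X (y s) - 1))"
      using X_gt[of "y s"] by (intro DERIV_real_sqrt) simp
    ultimately have sqrt_der: "((\<lambda>s. sqrt (X (y s) - 1)) has_real_derivative
        inverse (sqrt (X (y s) - 1)) / 2 * (2 * z s * w s)) (at s)"
      by (rule DERIV_chain2[where g = "\<lambda>s. X (y s) - 1", rotated])
    have cos_der: "((\<lambda>s. \<rho> * cos (\<Phi> s)) has_real_derivative \<rho> * (- sin (\<Phi> s) * (1 / h (\<Phi> s)))) (at s)"
      by (rule DERIV_cmult, rule DERIV_fun_cos[OF \<Phi>_der])
    have "(w has_real_derivative (\<rho> * (- sin (\<Phi> s) * (1 / h (\<Phi> s))) * sqrt (X (y s) - 1)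
        + inverse (sqrt (X (y s) - 1)) / 2 * (2 * z s * w s) * (\<rho> * cos (\<Phi> s))) / R) (at s)"
      unfolding w_def[abs_def] by (rule DERIV_cdivide, rule DERIV_mult[OF cos_der sqrt_der[unfolded w_def]])
    moreover have "\<rho> * (- sin (\<Phi> s) * (1 / h (\<Phi> s))) * sqrt (X (y s) - 1)
        = - ((x - p) * (f / ((p - 1) * x))) * z s / R"
    proof -
      have "\<rho> * (- sin (\<Phi> s) * (1 / h (\<Phi> s))) * sqrt (X (y s) - 1) = - (2 * y s) * (z s * (r * r)) / (R * D (y s))"
        by (simp add: y_def[of s, symmetric] h_def k_def z_def r_def x_def)
      also have "\<dots> = - ((x - p) * clairaut_slope p x) * (z s * (x - 1)) / R"
        unfolding D_eq[of "y s"] pos(5) using ne(3)[of "y s"] by (simp add: x_def)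
      also have "\<dots> = - ((x - p) * (f / ((p - 1) * x))) * z s / R"
        using pos(1) by (simp add: clairaut_slope_def f_def x_def)
      finally show ?thesis .
    qed
    moreover have "inverse (sqrt (X (y s) - 1)) / 2 * (2 * z s * w s) * (\<rho> * cos (\<Phi> s)) = (R\<^sup>2 - f) * z s / R"
    proof -
      have "inverse (sqrt (X (y s) - 1)) / 2 * (2 * z s * w s) * (\<rho> * cos (\<Phi> s)) = (\<rho>\<^sup>2 * (cos (\<Phi> s))\<^sup>2) * z s / R"
        using root(2)[of "y s"] by (simp add: w_def power2_eq_square field_simps)
      then show ?thesis by (simp only: energy f_def)
    qed
    moreover have "(- ((x - p) * (f / ((p - 1) * x))) * z s / R + (R\<^sup>2 - f) * z s / R) / R
        = z s - q * C\<^sup>2 * (z s powr q)\<^sup>2 / z s"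
    proof -
      have "q * C\<^sup>2 * (z s powr q)\<^sup>2 / z s = p / (p - 1) * (1 / R\<^sup>2) * (f * (x - 1)) * (z s / x)"
        unfolding zq C using pos by (simp add: q_def f_def x_def power_divide divide_simps)
      then show ?thesis
        using pos p by (simp add: power2_eq_square divide_simps) (simp add: algebra_simps)
    qed
    ultimately show ?thesis by simp
  qed
  have w2: "(w s)\<^sup>2 = (z s)\<^sup>2 - 1 - C\<^sup>2 * (z s powr q)\<^sup>2" if C: "C = 1 / R" for s C
  proof -
    have "(w s)\<^sup>2 = (\<rho>\<^sup>2 * (cos (\<Phi> s))\<^sup>2) * (X (y s) - 1) / R\<^sup>2"
      using X_gt[of "y s"] by (simp add: w_def power_divide power_mult_distrib)
    then show ?thesis
      unfolding energy zq z2 C using R by (simp add: power_divide field_simps)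
  qed
  have \<theta>_der: "(\<theta> has_real_derivative C * z s powr q / ((z s)\<^sup>2 - 1)) (at s)" if C: "C = 1 / R" for s C
  proof -
    have "(\<theta> has_real_derivative angle_density p X D (y s) * (1 / h (\<Phi> s))) (at s)"
      unfolding \<theta>_def y_def by (rule DERIV_chain2[OF A \<Phi>_der])
    moreover have "angle_density p X D (y s) * (1 / h (\<Phi> s)) = C * z s powr q / ((z s)\<^sup>2 - 1)"
    proof -
      have "z s powr q = sqrt (clairaut p (X (y s))) * sqrt (X (y s) - 1)"
        using zq[of s] by (metis powr_ge_zero real_sqrt_mult real_sqrt_unique)
      then show ?thesis
        unfolding z2 C angle_density_def h_def k_def y_def[symmetric]
        using root[of "y s"] ne[of "y s"] X_gt0[of "y s"] R by (simp add: divide_simps)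
    qed
    ultimately show ?thesis by simp
  qed
  show thesis
  proof (rule that[of "1 / R" P z w \<theta>, folded q_def])
    show "1 / R > 0" using R by simp
    have "H 0 < H (2 * pi)"
      using DERIV_pos_imp_increasing[of 0 "2 * pi" H] H h_pos pi_gt_zero by (metis mult_pos_pos zero_less_numeral)
    then show "P > 0" by (simp add: P_def)
    show "z (s + P) = z s" for s by (simp add: z_def y_def \<Phi>_shift)
    show "\<theta> (s + P) = \<theta> s + integral {0..2 * pi} (\<lambda>\<phi>. angle_density p X D (\<rho> * sin \<phi>))" for s
      by (simp add: \<theta>_def \<Phi>_shift A_shift)
    have "X 0 \<noteq> X \<rho>"
      using DERIV_pos_imp_increasing[of 0 \<rho> X] \<rho> X_der D_pos by (metis less_irrefl)
    then have "z (H 0) \<noteq> z (H (pi / 2))"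
      by (simp add: z_def y_def \<Phi>H)
    then show "\<exists>s t. z s \<noteq> z t" by blast
  qed (rule z_gt z_der w_der[OF refl] w2[OF refl] \<theta>_der[OF refl])+
qed

section \<open>Curves in the hyperbolic plane\<close>

text \<open>Smoothness is obtained from a differential algebra: if the derivatives of finitely many functions are
polynomials in these functions, then so are the derivatives of all polynomials in them, hence all such
polynomials are infinitely differentiable.\<close>

inductive_set generated_algebra :: "('a \<Rightarrow> real) set \<Rightarrow> ('a \<Rightarrow> real) set" for G where
  generator: "g \<in> G \<Longrightarrow> g \<in> generated_algebra G"
| const: "(\<lambda>_. c) \<in> generated_algebra G"
| add: "f \<in> generated_algebra G \<Longrightarrow> g \<in> generated_algebra G \<Longrightarrow> (\<lambda>s. f s + g s) \<in> generated_algebra G"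
| mult: "f \<in> generated_algebra G \<Longrightarrow> g \<in> generated_algebra G \<Longrightarrow> (\<lambda>s. f s * g s) \<in> generated_algebra G"

lemma generated_algebra_diff:
  assumes "f \<in> generated_algebra G" "g \<in> generated_algebra G"
  shows "(\<lambda>s. f s - g s) \<in> generated_algebra G"
proof -
  have "(\<lambda>s. f s + (-1) * g s) \<in> generated_algebra G"
    by (intro generated_algebra.intros assms)
  then show ?thesis by simp
qed

lemma generated_algebra_uminus:
  assumes "f \<in> generated_algebra G"
  shows "(\<lambda>s. - f s) \<in> generated_algebra G"
  using generated_algebra_diff[OF generated_algebra.const[of 0] assms] by simp

lemma generated_algebra_power:
  assumes "f \<in> generated_algebra G"
  shows "(\<lambda>s. f s ^ n) \<in> generated_algebra G"
  by (induction n) (auto intro: generated_algebra.intros assms)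

lemma generated_algebra_derivative:
  fixes G :: "(real \<Rightarrow> real) set"
  assumes G: "\<And>g. g \<in> G \<Longrightarrow> \<exists>g' \<in> generated_algebra G. \<forall>s. (g has_real_derivative g' s) (at s)"
    and f: "f \<in> generated_algebra G"
  shows "\<exists>f' \<in> generated_algebra G. \<forall>s. (f has_real_derivative f' s) (at s)"
  using f
proof induction
  case (generator g)
  then show ?case by (rule G)
next
  case (const c)
  show ?case by (rule bexI[of _ "\<lambda>_. 0"]) (auto intro: generated_algebra.intros)
next
  case (add f g)
  then obtain f' g' where "f' \<in> generated_algebra G" "g' \<in> generated_algebra G"
    "\<And>s. (f has_real_derivative f' s) (at s)" "\<And>s. (g has_real_derivative g' s) (at s)" by blast
  then show ?case
    by (intro bexI[of _ "\<lambda>s. f' s + g' s"]) (auto intro: generated_algebra.intros DERIV_add)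
next
  case (mult f g)
  then obtain f' g' where "f' \<in> generated_algebra G" "g' \<in> generated_algebra G"
    "\<And>s. (f has_real_derivative f' s) (at s)" "\<And>s. (g has_real_derivative g' s) (at s)" by blast
  with mult.hyps show ?case
    by (intro bexI[of _ "\<lambda>s. f' s * g s + g' s * f s"]) (auto intro: generated_algebra.intros DERIV_mult)
qed

lemma has_vector_derivative_componentwise_vec:
  fixes f :: "real \<Rightarrow> real^'n"
  assumes "\<And>i. ((\<lambda>s. f s $ i) has_real_derivative f' $ i) (at s)"
  shows "(f has_vector_derivative f') (at s)"
  unfolding has_vector_derivative_def
proof (subst has_derivative_componentwise_within, rule ballI)
  fix b :: "real^'n" assume "b \<in> Basis"
  then obtain i where "b = axis i 1" by (auto simp: Basis_vec_def)
  then show "((\<lambda>x. f x \<bullet> b) has_derivative (\<lambda>x. x *\<^sub>R f' \<bullet> b)) (at s)"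
    using assms[of i] by (simp add: inner_axis has_field_derivative_def mult.commute[of _ "f' $ i"])
qed

lemma smooth_map_of_generated_algebra:
  fixes G :: "(real \<Rightarrow> real) set" and f :: "real \<Rightarrow> real^3"
  assumes G: "\<And>g. g \<in> G \<Longrightarrow> \<exists>g' \<in> generated_algebra G. \<forall>s. (g has_real_derivative g' s) (at s)"
    and f: "\<And>i. (\<lambda>s. f s $ i) \<in> generated_algebra G"
  shows "smooth_map f"
proof -
  have step: "(\<forall>s. f differentiable at s) \<and> (\<forall>i. (\<lambda>s. vderiv f s $ i) \<in> generated_algebra G)"
    if f: "\<And>i. (\<lambda>s. f s $ i) \<in> generated_algebra G" for f :: "real \<Rightarrow> real^3"
  proof -
    obtain d where d: "\<And>i. d i \<in> generated_algebra G"
      "\<And>i s. ((\<lambda>s. f s $ i) has_real_derivative d i s) (at s)"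
      using generated_algebra_derivative[OF G f] by metis
    have D: "(f has_vector_derivative (\<chi> i. d i s)) (at s)" for s
      by (rule has_vector_derivative_componentwise_vec) (simp add: d)
    then have "vderiv f s = (\<chi> i. d i s)" for s
      by (simp add: vderiv_def vector_derivative_at)
    then show ?thesis using D d(1) by (auto intro: differentiableI_vector)
  qed
  have "(\<lambda>s. (vderiv ^^ k) f s $ i) \<in> generated_algebra G" for k i
    by (induction k arbitrary: i) (use f step in auto)
  then show ?thesis
    unfolding smooth_map_def using step
    by (metis differentiable_at_imp_differentiable_on)
qed

lemma has_real_derivative_lorentz:
  assumes "X differentiable (at s)" "Y differentiable (at s)"
  shows "((\<lambda>t. lorentz (X t) (Y t)) has_real_derivative
    lorentz (vderiv X s) (Y s) + lorentz (X s) (vderiv Y s)) (at s)"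
proof -
  have comp: "((\<lambda>t. Z t $ i) has_real_derivative vderiv Z s $ i) (at s)"
    if "Z differentiable (at s)" for Z :: "real \<Rightarrow> real^3" and i
    using bounded_linear.has_vector_derivative[OF bounded_linear_vec_nth
        that[unfolded vector_derivative_works]]
    by (simp add: vderiv_def has_real_derivative_iff_has_vector_derivative)
  show ?thesis
    unfolding lorentz_def
    by (rule derivative_eq_intros comp assms refl)+ (simp add: algebra_simps)
qed

text \<open>The Lorentzian cross product of x and u: the Euclidean one with its third component negated.  For
a point x of the hyperbolic plane and a unit tangent vector u it is the unit normal that completes u to
a positively oriented basis.\<close>

definition lorentz_normal :: "real^3 \<Rightarrow> real^3 \<Rightarrow> real^3" where
  "lorentz_normal x u = vector [x$2 * u$3 - x$3 * u$2, x$3 * u$1 - x$1 * u$3, x$2 * u$1 - x$1 * u$2]"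

lemma lorentz_normal_orthogonal:
  "lorentz (lorentz_normal x u) x = 0" "lorentz (lorentz_normal x u) u = 0"
  by (simp_all add: lorentz_def lorentz_normal_def vector_3 algebra_simps)

lemma lorentz_normal_norm:
  "lorentz (lorentz_normal x u) (lorentz_normal x u) = (lorentz x u)\<^sup>2 - lorentz x x * lorentz u u"
  by (simp add: lorentz_def lorentz_normal_def vector_3 algebra_simps power2_eq_square)

lemma det_lorentz_normal:
  "det (vector [x, u, lorentz_normal x u] :: real^3^3) = lorentz (lorentz_normal x u) (lorentz_normal x u)"
  by (simp add: det_3 lorentz_def lorentz_normal_def vector_3 algebra_simps)

text \<open>The covariant derivative of the tangent is orthogonal to the position and to the tangent, hence a
multiple of the normal.  Since it equals the ambient acceleration minus the position, the factor can be read off from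
third components alone, as soon as the normal has a nonzero one.\<close>

lemma signed_curvature_from_height:
  assumes \<gamma>: "unit_speed_curve \<gamma>"
    and transverse: "\<And>s. lorentz_normal (\<gamma> s) (vderiv \<gamma> s) $ 3 \<noteq> 0"
    and height: "\<And>s. vderiv (vderiv \<gamma>) s $ 3 - \<gamma> s $ 3 = \<kappa> s * lorentz_normal (\<gamma> s) (vderiv \<gamma> s) $ 3"
  shows "signed_curvature \<gamma> \<kappa>"
proof -
  define T where "T = vderiv \<gamma>"
  define N where "N s = lorentz_normal (\<gamma> s) (T s)" for s
  have d\<gamma>: "\<gamma> differentiable (at s)" and dT: "T differentiable (at s)" for s
    using \<gamma>[unfolded unit_speed_curve_def smooth_map_def, THEN conjunct1, THEN spec, of 0]
      \<gamma>[unfolded unit_speed_curve_def smooth_map_def, THEN conjunct1, THEN spec, of 1]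
    by (simp_all add: T_def differentiable_on_eq_differentiable_at)
  have H: "\<gamma> s \<in> hyperbolic_plane" and \<gamma>\<gamma>: "lorentz (\<gamma> s) (\<gamma> s) = -1" and TT: "lorentz (T s) (T s) = 1" for s
    using \<gamma> by (auto simp: unit_speed_curve_def hyperbolic_plane_def T_def)
  have sym: "lorentz u v = lorentz v u" for u v by (simp add: lorentz_def mult.commute)
  have \<gamma>T: "lorentz (T s) (\<gamma> s) = 0" for s
    using DERIV_unique[OF has_real_derivative_lorentz[OF d\<gamma> d\<gamma>, of s, unfolded \<gamma>\<gamma>] DERIV_const]
    by (simp add: T_def sym[of "\<gamma> s"])
  have \<gamma>T': "lorentz (vderiv T s) (\<gamma> s) = -1" for s
    using DERIV_unique[OF has_real_derivative_lorentz[OF dT d\<gamma>, of s, unfolded \<gamma>T] DERIV_const] TT[of s]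
    by (simp add: T_def)
  have TT': "lorentz (vderiv T s) (T s) = 0" for s
    using DERIV_unique[OF has_real_derivative_lorentz[OF dT dT, of s, unfolded TT] DERIV_const]
    by (simp add: sym[of "T s"])
  have NN: "lorentz (N s) (N s) = 1" for s
    using \<gamma>T[of s] by (simp add: N_def lorentz_normal_norm \<gamma>\<gamma> TT sym[of "\<gamma> s"])
  have "unit_normal \<gamma> N"
    unfolding unit_normal_def positively_oriented_def T_def[symmetric]
    using NN by (simp add: N_def lorentz_normal_orthogonal det_lorentz_normal)
  moreover have "cov_deriv \<gamma> T s = \<kappa> s *\<^sub>R N s" for s
  proof -
    define v where "v = cov_deriv \<gamma> T s - \<kappa> s *\<^sub>R N s"
    have cov: "cov_deriv \<gamma> T s = vderiv T s - \<gamma> s"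
      by (simp add: cov_deriv_def tangential_part_def \<gamma>T')
    have lin: "lorentz (a - b - c *\<^sub>R d) e = lorentz a e - lorentz b e - c * lorentz d e" for a b c d e
      by (simp add: lorentz_def algebra_simps)
    have "lorentz v (\<gamma> s) = 0"
      unfolding v_def cov lin by (simp add: N_def lorentz_normal_orthogonal \<gamma>T' \<gamma>\<gamma>)
    moreover have "lorentz v (T s) = 0"
      unfolding v_def cov lin using \<gamma>T[of s] by (simp add: N_def lorentz_normal_orthogonal TT' sym[of "\<gamma> s"])
    moreover have v3: "v $ 3 = 0"
      using height[of s] cov by (simp add: v_def N_def T_def)
    ultimately have v12: "v$1 * \<gamma> s$1 + v$2 * \<gamma> s$2 = 0" "v$1 * T s$1 + v$2 * T s$2 = 0"
      by (simp_all add: lorentz_def)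
    define m where "m = N s $ 3"
    have m: "m = \<gamma> s$2 * T s$1 - \<gamma> s$1 * T s$2" "m \<noteq> 0"
      using transverse[of s] by (simp_all add: m_def N_def T_def lorentz_normal_def vector_3)
    \<comment> \<open>Up to sign, the number m is the determinant of the linear system for the first two components of v.\<close>
    have "v$1 * m = 0" "v$2 * m = 0"
      unfolding m(1) using v12 by algebra+
    then have "v = 0" using v3 m(2) by (simp add: vec_eq_iff forall_3)
    then show ?thesis by (simp add: v_def)
  qed
  ultimately show ?thesis unfolding signed_curvature_def T_def by blast
qed

section \<open>Elastic curves and closing them up\<close>

text \<open>The third component of the normal is -r^2 \<theta>' = - C z^q, and the height satisfies
z'' - z = - q C^2 z^(2 q - 1), so the curvature is q C z^(q - 1).  Because (q - 1) (p - 1) = 1, its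
(p - 1)-th power is a constant multiple of z, and once the second derivative of z is inserted the
elastic equation reduces to (p - 1) q = p.\<close>

lemma p_elastic_of_height_equation:
  fixes p C :: real and z w \<theta> :: "real \<Rightarrow> real"
  defines "q \<equiv> p / (p - 1)"
  assumes p: "p > 1" and C: "C > 0" and z_gt: "\<And>s. z s > 1"
    and z_der: "\<And>s. (z has_real_derivative w s) (at s)"
    and w_der: "\<And>s. (w has_real_derivative z s - q * C\<^sup>2 * (z s powr q)\<^sup>2 / z s) (at s)"
    and energy: "\<And>s. (w s)\<^sup>2 = (z s)\<^sup>2 - 1 - C\<^sup>2 * (z s powr q)\<^sup>2"
    and \<theta>_der: "\<And>s. (\<theta> has_real_derivative C * z s powr q / ((z s)\<^sup>2 - 1)) (at s)"
  shows "p_elastic p (\<lambda>s. vector [sqrt ((z s)\<^sup>2 - 1) * cos (\<theta> s), sqrt ((z s)\<^sup>2 - 1) * sin (\<theta> s), z s])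
           (\<lambda>s. q * C * z s powr (q - 1))"
proof -
  have q: "q > 1" "(q - 1) * (p - 1) = 1" "(p - 1) * q = p" using p by (simp_all add: q_def field_simps)
  define V where "V s = z s powr q" for s
  define r where "r s = sqrt ((z s)\<^sup>2 - 1)" for s
  define \<gamma> where "\<gamma> s = (vector [r s * cos (\<theta> s), r s * sin (\<theta> s), z s] :: real^3)" for s
  define \<kappa> where "\<kappa> s = q * C * z s powr (q - 1)" for s
  have z0: "z s > 0" "z s \<noteq> 0" for s using z_gt[of s] by auto
  have z2_gt: "(z s)\<^sup>2 - 1 > 0" for s
    using one_less_power[OF z_gt[of s], of 2] by linarith
  have r2: "(r s)\<^sup>2 = (z s)\<^sup>2 - 1" for s
    unfolding r_def by (rule real_sqrt_pow2) (use z2_gt[of s] in simp)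
  have r0: "r s > 0" "r s \<noteq> 0" for s
    using z2_gt[of s] real_sqrt_gt_zero[OF z2_gt[of s]] by (auto simp: r_def)
  have V0: "V s > 0" for s using z0[of s] by (simp add: V_def)
  have \<kappa>_eq: "\<kappa> s = q * C * V s / z s" and \<kappa>0: "\<kappa> s > 0" for s
    using z0[of s] q C by (simp_all add: \<kappa>_def V_def powr_diff)
  have V_der: "(V has_real_derivative q * (V s * inverse (z s)) * w s) (at s)" for s
  proof -
    have "((\<lambda>s. z s powr q) has_real_derivative q * z s powr (q - 1) * w s) (at s)"
      using z0[of s] by (auto intro!: derivative_eq_intros z_der)
    then show ?thesis
      using z0[of s] by (simp add: V_def[abs_def] powr_diff divide_inverse)
  qed
  have r_der: "(r has_real_derivative z s * w s * inverse (r s)) (at s)" for s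
  proof -
    have "((\<lambda>s. (z s)\<^sup>2 - 1) has_real_derivative 2 * z s * w s) (at s)"
      by (auto intro!: derivative_eq_intros z_der)
    moreover have "(sqrt has_real_derivative inverse (r s) / 2) (at ((z s)\<^sup>2 - 1))"
      unfolding r_def using r2[of s] r0[of s] by (intro DERIV_real_sqrt) (simp flip: r2)
    ultimately have "((\<lambda>s. sqrt ((z s)\<^sup>2 - 1)) has_real_derivative inverse (r s) / 2 * (2 * z s * w s)) (at s)"
      by (rule DERIV_chain2[where g = "\<lambda>s. (z s)\<^sup>2 - 1", rotated])
    then show ?thesis by (simp add: r_def[abs_def] mult_ac)
  qed
  define \<omega> where "\<omega> s = C * V s * (inverse (r s))\<^sup>2" for s
  have \<theta>_der': "(\<theta> has_real_derivative \<omega> s) (at s)" for s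
    using \<theta>_der[of s] by (simp add: \<omega>_def V_def r2[symmetric] power_inverse divide_inverse)
  \<comment> \<open>The derivatives of V, r and \<theta> bring in reciprocals of z and r, which are therefore adjoined as generators.\<close>
  define inv_z inv_r cos_\<theta> sin_\<theta> where
    "inv_z s = inverse (z s)" and "inv_r s = inverse (r s)" and
    "cos_\<theta> s = cos (\<theta> s)" and "sin_\<theta> s = sin (\<theta> s)" for s
  define G where "G = {z, w, V, r, inv_z, inv_r, cos_\<theta>, sin_\<theta>}"
  let ?A = "generated_algebra G"
  have gens: "z \<in> ?A" "w \<in> ?A" "V \<in> ?A" "r \<in> ?A" "inv_z \<in> ?A" "inv_r \<in> ?A" "cos_\<theta> \<in> ?A" "sin_\<theta> \<in> ?A"
    by (auto intro: generated_algebra.generator simp: G_def)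
  note closure = generated_algebra.const generated_algebra.add generated_algebra.mult
    generated_algebra_diff generated_algebra_uminus generated_algebra_power gens
  have G_closed: "\<exists>g' \<in> ?A. \<forall>s. (g has_real_derivative g' s) (at s)" if "g \<in> G" for g
  proof -
    have closed: ?thesis if "g = f" "f' \<in> ?A" "\<And>s. (f has_real_derivative f' s) (at s)" for f f'
      using that by blast
    consider "g = z" | "g = w" | "g = V" | "g = r" | "g = inv_z" | "g = inv_r" | "g = cos_\<theta>" | "g = sin_\<theta>"
      using \<open>g \<in> G\<close> by (auto simp: G_def)
    then show ?thesis
    proof cases
      case 1
      then show ?thesis by (rule closed[of _ w]) (rule gens z_der)+
    next
      case 2
      then show ?thesis
      proof (rule closed[of _ "\<lambda>s. z s - (q * C\<^sup>2) * ((V s)\<^sup>2 * inv_z s)"])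
        show "(\<lambda>s. z s - (q * C\<^sup>2) * ((V s)\<^sup>2 * inv_z s)) \<in> ?A" by (intro closure)
        show "(w has_real_derivative z s - (q * C\<^sup>2) * ((V s)\<^sup>2 * inv_z s)) (at s)" for s
          using w_der[of s] by (simp add: V_def inv_z_def divide_inverse mult_ac)
      qed
    next
      case 3
      then show ?thesis
      proof (rule closed[of _ "\<lambda>s. q * (V s * inv_z s) * w s"])
        show "(\<lambda>s. q * (V s * inv_z s) * w s) \<in> ?A" by (intro closure)
        show "(V has_real_derivative q * (V s * inv_z s) * w s) (at s)" for s
          using V_der by (simp add: inv_z_def)
      qed
    next
      case 4
      then show ?thesis
      proof (rule closed[of _ "\<lambda>s. z s * w s * inv_r s"])
        show "(\<lambda>s. z s * w s * inv_r s) \<in> ?A" by (intro closure)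
        show "(r has_real_derivative z s * w s * inv_r s) (at s)" for s
          using r_der by (simp add: inv_r_def)
      qed
    next
      case 5
      then show ?thesis
      proof (rule closed[of _ "\<lambda>s. - (w s * (inv_z s)\<^sup>2)"])
        show "(\<lambda>s. - (w s * (inv_z s)\<^sup>2)) \<in> ?A" by (intro closure)
        show "(inv_z has_real_derivative - (w s * (inv_z s)\<^sup>2)) (at s)" for s
          using DERIV_inverse_fun[OF z_der z0(2), of s]
          by (simp add: inv_z_def[abs_def] power2_eq_square mult_ac)
      qed
    next
      case 6
      then show ?thesis
      proof (rule closed[of _ "\<lambda>s. - (z s * w s * inv_r s * (inv_r s)\<^sup>2)"])
        show "(\<lambda>s. - (z s * w s * inv_r s * (inv_r s)\<^sup>2)) \<in> ?A" by (intro closure)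
        show "(inv_r has_real_derivative - (z s * w s * inv_r s * (inv_r s)\<^sup>2)) (at s)" for s
          using DERIV_inverse_fun[OF r_der r0(2), of s]
          by (simp add: inv_r_def[abs_def] power2_eq_square mult_ac)
      qed
    next
      case 7
      then show ?thesis
      proof (rule closed[of _ "\<lambda>s. - (sin_\<theta> s * (C * V s * (inv_r s)\<^sup>2))"])
        show "(\<lambda>s. - (sin_\<theta> s * (C * V s * (inv_r s)\<^sup>2))) \<in> ?A" by (intro closure)
        show "(cos_\<theta> has_real_derivative - (sin_\<theta> s * (C * V s * (inv_r s)\<^sup>2))) (at s)" for s
          using DERIV_fun_cos[OF \<theta>_der', of s]
          by (simp add: cos_\<theta>_def[abs_def] sin_\<theta>_def inv_r_def \<omega>_def)
      qed
    next
      case 8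
      then show ?thesis
      proof (rule closed[of _ "\<lambda>s. cos_\<theta> s * (C * V s * (inv_r s)\<^sup>2)"])
        show "(\<lambda>s. cos_\<theta> s * (C * V s * (inv_r s)\<^sup>2)) \<in> ?A" by (intro closure)
        show "(sin_\<theta> has_real_derivative cos_\<theta> s * (C * V s * (inv_r s)\<^sup>2)) (at s)" for s
          using DERIV_fun_sin[OF \<theta>_der', of s]
          by (simp add: sin_\<theta>_def[abs_def] cos_\<theta>_def inv_r_def \<omega>_def)
      qed
    qed
  qed
  have smooth: "smooth_map \<gamma>"
  proof (rule smooth_map_of_generated_algebra[OF G_closed])
    have "(\<lambda>s. r s * cos_\<theta> s) \<in> ?A" "(\<lambda>s. r s * sin_\<theta> s) \<in> ?A" by (intro closure)+
    then have "\<forall>i. (\<lambda>s. \<gamma> s $ i) \<in> ?A"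
      using gens(1) by (simp add: forall_3 \<gamma>_def vector_3 cos_\<theta>_def sin_\<theta>_def)
    then show "(\<lambda>s. \<gamma> s $ i) \<in> ?A" for i by blast
  qed
  define T where "T s = (vector [z s * w s * inverse (r s) * cos (\<theta> s) - r s * \<omega> s * sin (\<theta> s),
      z s * w s * inverse (r s) * sin (\<theta> s) + r s * \<omega> s * cos (\<theta> s), w s] :: real^3)" for s
  have T: "vderiv \<gamma> s = T s" for s
  proof -
    have "\<forall>i. ((\<lambda>s. \<gamma> s $ i) has_real_derivative T s $ i) (at s)"
      unfolding forall_3
      using DERIV_mult[OF r_der[of s] DERIV_fun_cos[OF \<theta>_der', of s]]
        DERIV_mult[OF r_der[of s] DERIV_fun_sin[OF \<theta>_der', of s]] z_der[of s]
      by (simp add: \<gamma>_def T_def vector_3 mult_ac)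
    then show ?thesis
      unfolding vderiv_def by (intro vector_derivative_at has_vector_derivative_componentwise_vec) blast
  qed
  have angular: "(r s)\<^sup>2 * \<omega> s = C * V s" for s
    using r0(2)[of s] by (simp add: \<omega>_def power_inverse)
  have unit: "unit_speed_curve \<gamma>"
    unfolding unit_speed_curve_def
  proof (intro conjI allI smooth)
    fix s
    have cs: "(cos (\<theta> s))\<^sup>2 + (sin (\<theta> s))\<^sup>2 = 1" by simp
    have "lorentz (\<gamma> s) (\<gamma> s) = (r s)\<^sup>2 * ((cos (\<theta> s))\<^sup>2 + (sin (\<theta> s))\<^sup>2) - (z s)\<^sup>2"
      by (simp add: lorentz_def \<gamma>_def vector_3 power2_eq_square algebra_simps
          del: sin_cos_squared_add sin_cos_squared_add2 sin_cos_squared_add3)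
    then show "\<gamma> s \<in> hyperbolic_plane"
      using z0[of s] unfolding cs by (simp add: hyperbolic_plane_def r2) (simp add: \<gamma>_def vector_3)
    have "lorentz (T s) (T s)
        = ((z s * w s * inverse (r s))\<^sup>2 + (r s * \<omega> s)\<^sup>2) * ((cos (\<theta> s))\<^sup>2 + (sin (\<theta> s))\<^sup>2) - (w s)\<^sup>2"
      by (simp add: lorentz_def T_def vector_3 power2_eq_square algebra_simps
          del: sin_cos_squared_add sin_cos_squared_add2 sin_cos_squared_add3)
    also have "\<dots> = ((z s * w s)\<^sup>2 + ((r s)\<^sup>2 * \<omega> s)\<^sup>2 - (w s)\<^sup>2 * (r s)\<^sup>2) / (r s)\<^sup>2"
      using r0(2)[of s] unfolding cs by (simp add: power2_eq_square field_simps)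
    also have "(z s * w s)\<^sup>2 + ((r s)\<^sup>2 * \<omega> s)\<^sup>2 - (w s)\<^sup>2 * (r s)\<^sup>2 = (w s)\<^sup>2 + C\<^sup>2 * (V s)\<^sup>2"
      unfolding angular by (simp add: r2 power_mult_distrib algebra_simps)
    also have "\<dots> = (r s)\<^sup>2" by (simp add: energy r2 V_def)
    finally show "lorentz (vderiv \<gamma> s) (vderiv \<gamma> s) = 1"
      using r0(2)[of s] by (simp add: T)
  qed
  have normal3: "lorentz_normal (\<gamma> s) (vderiv \<gamma> s) $ 3 = - (C * V s)" for s
  proof -
    have "lorentz_normal (\<gamma> s) (T s) $ 3 = - ((r s)\<^sup>2 * \<omega> s) * ((cos (\<theta> s))\<^sup>2 + (sin (\<theta> s))\<^sup>2)"
      by (simp add: lorentz_normal_def \<gamma>_def T_def vector_3 power2_eq_square algebra_simps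
          del: sin_cos_squared_add sin_cos_squared_add2 sin_cos_squared_add3)
    then show ?thesis by (simp add: T angular)
  qed
  have "signed_curvature \<gamma> \<kappa>"
  proof (rule signed_curvature_from_height[OF unit])
    show "lorentz_normal (\<gamma> s) (vderiv \<gamma> s) $ 3 \<noteq> 0" for s
      using C V0[of s] by (simp add: normal3)
    have "T differentiable (at s)" for s
      using unit[unfolded unit_speed_curve_def smooth_map_def, THEN conjunct1, THEN spec, of 1]
      by (simp add: differentiable_on_eq_differentiable_at T[abs_def, symmetric])
    then have "((\<lambda>s. T s $ 3) has_real_derivative vderiv T s $ 3) (at s)" for s
      using bounded_linear.has_vector_derivative[OF bounded_linear_vec_nth, of T "vderiv T s" "at s" 3]
      by (simp add: vderiv_def has_real_derivative_iff_has_vector_derivative vector_derivative_works)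
    then have "(w has_real_derivative vderiv T s $ 3) (at s)" for s
      by (simp add: T_def vector_3)
    then have "vderiv T s $ 3 = z s - q * C\<^sup>2 * (V s)\<^sup>2 / z s" for s
      using DERIV_unique w_der unfolding V_def by blast
    moreover have "vderiv \<gamma> = T" using T by blast
    ultimately show "vderiv (vderiv \<gamma>) s $ 3 - \<gamma> s $ 3 = \<kappa> s * lorentz_normal (\<gamma> s) (vderiv \<gamma> s) $ 3" for s
      unfolding normal3 \<kappa>_eq by (simp add: \<gamma>_def vector_3 power2_eq_square)
  qed
  moreover have "p * (deriv ^^ 2) (\<lambda>t. rpow (\<kappa> t) (p - 1)) s
      + (p - 1) * rpow (\<kappa> s) (p + 1) - p * rpow (\<kappa> s) (p - 1) = 0" for s
  proof -
    define K where "K = (q * C) powr (p - 1)"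
    have u: "rpow (\<kappa> t) (p - 1) = K * z t" for t
    proof -
      have "rpow (\<kappa> t) (p - 1) = (q * C * z t powr (q - 1)) powr (p - 1)"
        using rpow_pos[OF \<kappa>0[of t]] by (simp add: \<kappa>_def)
      also have "\<dots> = K * z t powr ((q - 1) * (p - 1))"
        using q(1) C z0[of t] by (simp add: K_def powr_mult powr_powr)
      finally show ?thesis using z0[of t] by (simp add: q(2))
    qed
    have "deriv (\<lambda>t. K * z t) = (\<lambda>t. K * w t)"
      by (intro ext DERIV_imp_deriv DERIV_cmult z_der)
    then have "(deriv ^^ 2) (\<lambda>t. K * z t) s = K * (z s - q * C\<^sup>2 * (V s)\<^sup>2 / z s)"
      using DERIV_imp_deriv[OF DERIV_cmult[OF w_der[of s], of K]]
      by (simp add: numeral_2_eq_2 V_def)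
    moreover have "rpow (\<kappa> s) (p + 1) = (q * C * V s / z s)\<^sup>2 * (K * z s)"
    proof -
      have "\<kappa> s powr (p + 1) = \<kappa> s powr 2 * \<kappa> s powr (p - 1)"
        by (simp add: add.commute flip: powr_add)
      then show ?thesis
        using rpow_pos[OF \<kappa>0[of s]] u[of s] \<kappa>0[of s] by (simp add: \<kappa>_eq)
    qed
    moreover have "p * (K * (z s - q * C\<^sup>2 * (V s)\<^sup>2 / z s)) + (p - 1) * ((q * C * V s / z s)\<^sup>2 * (K * z s)) - p * (K * z s)
        = ((p - 1) * q - p) * (q * C\<^sup>2 * (V s)\<^sup>2 * K / z s)"
      using z0(2)[of s] by (simp add: power2_eq_square field_simps)
    ultimately show ?thesis
      unfolding u by (simp only: q(3) diff_self mult_zero_left)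
  qed
  ultimately have "p_elastic p \<gamma> \<kappa>"
    unfolding p_elastic_def using unit \<kappa>0 by blast
  then show ?thesis
    by (simp add: \<gamma>_def[abs_def] \<kappa>_def[abs_def] r_def)
qed

lemma quasiperiodic_iterate:
  fixes f :: "real \<Rightarrow> real"
  assumes "\<And>s. f (s + P) = f s + c"
  shows "f (s + real m * P) = f s + real m * c"
proof (induction m)
  case (Suc m)
  have "f (s + real (Suc m) * P) = f ((s + real m * P) + P)" by (simp add: algebra_simps)
  also have "\<dots> = f s + real (Suc m) * c"
    unfolding assms Suc by (simp add: algebra_simps)
  finally show ?case .
qed simp

theorem corollary5p3:
  fixes p :: real and n m :: nat
  assumes "p > 1"
    and "coprime n m"
    and "real m < 2 * real n"
    and "2 * real n < sqrt 2 * real m"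
  shows "\<exists>\<gamma> \<kappa>. p_elastic p \<gamma> \<kappa> \<and> closed_curve \<gamma> \<and> \<not> \<kappa> constant_on UNIV"
proof -
  note p = \<open>p > 1\<close>
  have m: "m > 0" using assms(3,4) by (cases m) auto
  obtain X D where X: "\<And>y. X y > 1" "\<And>y. clairaut p (X y) = clairaut p p + y\<^sup>2"
      "\<And>y. (X has_real_derivative D y) (at y)"
    and D: "continuous_on UNIV D" "\<And>y. D y > 0"
      "\<And>y. 2 * y = (X y - p) * clairaut_slope p (X y) * D y"
    and X0: "X 0 = p" "D 0 = sqrt (2 / clairaut_slope p p)"
    and X_lim: "(X \<longlongrightarrow> 1) at_bot" "filterlim X at_top at_top"
    using clairaut_coordinate[OF p] by metis
  note density = angle_density_profile[where X = X and D = D, OF p X D(1,3) X0 X_lim]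
  define c where "c = 2 * pi * (real n / real m)"
  have "pi * (1 + 0) < c"
    using assms(3) m by (simp add: c_def field_simps)
  moreover have "c < 2 * pi * angle_density p X D 0"
  proof -
    have "c = pi * (2 * real n / real m)" by (simp add: c_def)
    also have "\<dots> < pi * sqrt 2"
      using assms(4) m by (intro mult_strict_left_mono) (auto simp: divide_less_eq)
    also have "\<dots> = 2 * pi * angle_density p X D 0"
      by (simp add: density(2) field_simps)
    finally show ?thesis .
  qed
  ultimately obtain \<rho> where \<rho>: "\<rho> > 0"
      "integral {0..2 * pi} (\<lambda>\<phi>. angle_density p X D (\<rho> * sin \<phi>)) = c"
    by (rule sinusoidal_average_attains[OF density(1,3,4)])
  obtain z w \<theta> :: "real \<Rightarrow> real" and C P :: real where
    pos: "C > 0" "P > 0" "\<And>s. z s > 1"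
    and ode: "\<And>s. (z has_real_derivative w s) (at s)"
      "\<And>s. (w has_real_derivative z s - p / (p - 1) * C\<^sup>2 * (z s powr (p / (p - 1)))\<^sup>2 / z s) (at s)"
      "\<And>s. (w s)\<^sup>2 = (z s)\<^sup>2 - 1 - C\<^sup>2 * (z s powr (p / (p - 1)))\<^sup>2"
      "\<And>s. (\<theta> has_real_derivative C * z s powr (p / (p - 1)) / ((z s)\<^sup>2 - 1)) (at s)"
    and per: "\<And>s. z (s + P) = z s" "\<And>s. \<theta> (s + P) = \<theta> s + c"
    and nonconst: "\<exists>s t. z s \<noteq> z t"
  proof (rule height_equation_solution[where X = X and D = D, OF p \<rho>(1) X D density(1), unfolded \<rho>(2)])
    fix z w \<theta> :: "real \<Rightarrow> real" and C P :: real
    assume "C > 0" "P > 0" "\<And>s. z s > 1" "\<And>s. (z has_real_derivative w s) (at s)"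
      "\<And>s. (w has_real_derivative z s - p / (p - 1) * C\<^sup>2 * (z s powr (p / (p - 1)))\<^sup>2 / z s) (at s)"
      "\<And>s. (w s)\<^sup>2 = (z s)\<^sup>2 - 1 - C\<^sup>2 * (z s powr (p / (p - 1)))\<^sup>2"
      "\<And>s. (\<theta> has_real_derivative C * z s powr (p / (p - 1)) / ((z s)\<^sup>2 - 1)) (at s)"
      "\<And>s. z (s + P) = z s" "\<And>s. \<theta> (s + P) = \<theta> s + c" "\<exists>s t. z s \<noteq> z t"
    then show thesis by (rule that[of C P z w \<theta>])
  qed
  define \<gamma> where "\<gamma> s = (vector [sqrt ((z s)\<^sup>2 - 1) * cos (\<theta> s), sqrt ((z s)\<^sup>2 - 1) * sin (\<theta> s), z s] :: real^3)" for s
  define \<kappa> where "\<kappa> s = p / (p - 1) * C * z s powr (p / (p - 1) - 1)" for s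
  have "p_elastic p \<gamma> \<kappa>"
    unfolding \<gamma>_def[abs_def] \<kappa>_def[abs_def] by (rule p_elastic_of_height_equation[OF p pos(1,3) ode])
  moreover have "closed_curve \<gamma>"
    unfolding closed_curve_def
  proof (intro exI[of _ "real m * P"] conjI allI)
    show "real m * P > 0" using m pos(2) by simp
    fix s
    have "z (s + real m * P) = z s"
      using quasiperiodic_iterate[of z P 0] per(1) by simp
    moreover have "\<theta> (s + real m * P) = \<theta> s + 2 * pi * real n"
      using quasiperiodic_iterate[of \<theta> P c, OF per(2), of s m] m by (simp add: c_def)
    moreover have "cos (x + 2 * pi * real n) = cos x" "sin (x + 2 * pi * real n) = sin x" for x
      using cos_int_2pin[of "int n"] sin_int_2pin[of "int n"] by (simp_all add: cos_add sin_add)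
    ultimately show "\<gamma> (s + real m * P) = \<gamma> s" by (simp add: \<gamma>_def)
  qed
  moreover have "\<not> \<kappa> constant_on UNIV"
  proof
    assume "\<kappa> constant_on UNIV"
    then obtain k where k: "\<And>s. \<kappa> s = k" by (auto simp: constant_on_def)
    obtain s t where "z s \<noteq> z t" using nonconst by blast
    \<comment> \<open>The curvature is a strictly increasing function of the height.\<close>
    have e: "p / (p - 1) - 1 > 0" using p by (simp add: field_simps)
    have "p / (p - 1) * C \<noteq> 0" using p pos(1) by simp
    moreover have "p / (p - 1) * C * z s powr (p / (p - 1) - 1) = p / (p - 1) * C * z t powr (p / (p - 1) - 1)"
      using k[of s] k[of t] by (simp only: \<kappa>_def)
    ultimately have "z s powr (p / (p - 1) - 1) = z t powr (p / (p - 1) - 1)"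
      by (metis mult_left_cancel)
    then show False
      using \<open>z s \<noteq> z t\<close> powr_less_mono2[OF e, of "z s" "z t"] powr_less_mono2[OF e, of "z t" "z s"] pos(3)[of s] pos(3)[of t]
      by (cases "z s" "z t" rule: linorder_cases) auto
  qed
  ultimately show ?thesis by blast
qed

end
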